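(* Let $n \geq 2$ be an integer and let $\Gamma$ be a finite connected graph that is locally $n \times n$ grid. Then every $\mu$-graph of $\Gamma$ has even order at least $4$ and at most $2n$. Moreover: (1) If all $\mu$-graphs of $\Gamma$ have order at least $n-1$, then (for this $n$) there are only finitely many such graphs $\Gamma$, and they satisfy \[ |V(\Gamma)| \leq \frac{n^3(n+5)}{4} \quad\text{and}\quad \operatorname{diam}(\Gamma) \leq 2 + \left\lceil \frac{\ln(n^2(n-1))}{2\ln\left(\frac{n+1}{n-1}\right)} \right\rceil. \] (2) If all $\mu$-graphs of $\Gamma$ have order at least $2(n-1)$, then \[ |V(\Gamma)| \leq \left\lfloor \frac{(n^2+1)(n+1)}{2} \right\rfloor \quad\text{and}\quad \operatorname{diam}(\Gamma) \leq 3. \] (3) Assume all $\mu$-graphs of $\Gamma$ have order at least $2(n-1)$. Then $|V(\Gamma)| = \lfloor (n^2+1)(n+1)/2 \rfloor$ if and only if all $\mu$-graphs of $\Gamma$ have order exactly $2(n-1)$; and in this case $n$ is odd, $\operatorname{diam}(\Gamma) = 3$, and $\Gamma$ is a distance-regular antipodal $((n+1)/2)$-cover of $K_{n^2+1}$ with intersection array $(n^2, (n-1)^2, 1; 1, 2(n-1), n^2)$.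
   Context: All graphs are finite, simple and undirected. $K_n \square K_n$ denotes the Cartesian product of two complete graphs on $n$ vertices (the $n\times n$ grid: vertices are pairs $(i,j)$, $1\le i,j\le n$, two pairs adjacent iff they agree in exactly one coordinate). A graph $\Gamma$ is locally $n\times n$ grid if for every vertex $x$ the induced subgraph on the neighbourhood $\Gamma(x)$ is isomorphic to $K_n \square K_n$. For vertices $x,y$ at distance $2$, the $\mu$-graph $\mu(x,y)$ is the induced subgraph on $\Gamma(x)\cap\Gamma(y)$; its order is $|\Gamma(x)\cap\Gamma(y)|$. A connected graph of diameter $D$ is distance-regular with intersection array $(b_0,\dots,b_{D-1};c_1,\dots,c_D)$ if for all vertices $x,y$ with $d(x,y)=i$, the number of neighbours of $y$ at distance $i+1$ from $x$ is $b_i$ and the number at distance $i-1$ from $x$ is $c_i$. A distance-regular graph of diameter $3$ is an antipodal $r$-cover of $K_N$ if the relation "equal or at distance $3$" is an equivalence relation whose classes (antipodal blocks) all have size $r$, and the quotient graph on the $N$ classes (two classes adjacent iff some vertices in them are adjacent) is $K_N$. *)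

theory Defs
  imports Complex_Main "Graph_Theory.Graph_Theory"
begin

text \<open>
  Graphs are finite, simple and undirected: records of type \<^typ>\<open>'a pair_pre_digraph\<close>
  satisfying \<^const>\<open>pair_graph\<close> (finite, loopless, symmetric arc relation).  The coercion
  \<^const>\<open>with_proj\<close> turns them into the general digraphs on which walks, connectedness,
  induced subgraphs and isomorphism are defined in the library.
\<close>

definition neighbourhood :: "'a pair_pre_digraph \<Rightarrow> 'a \<Rightarrow> 'a set" where
  "neighbourhood G x = {y. (x, y) \<in> parcs G}"

text \<open>
  The least length of a walk.  It is only used in connected graphs; if there is no walk
  from \<open>x\<close> to \<open>y\<close>, the value is the meaningless infimum of the empty set of naturals.
\<close>

definition graph_dist :: "'a pair_pre_digraph \<Rightarrow> 'a \<Rightarrow> 'a \<Rightarrow> nat" where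
  "graph_dist G x y = Inf {length p | p. pre_digraph.awalk (with_proj G) x p y}"

definition diameter :: "'a pair_pre_digraph \<Rightarrow> nat" where
  "diameter G = Max {graph_dist G x y | x y. x \<in> pverts G \<and> y \<in> pverts G}"

definition complete_graph :: "nat \<Rightarrow> nat pair_pre_digraph" where
  "complete_graph n = \<lparr> pverts = {1..n}, parcs = {(i, j). i \<in> {1..n} \<and> j \<in> {1..n} \<and> i \<noteq> j} \<rparr>"

definition cartesian_product ::
    "'a pair_pre_digraph \<Rightarrow> 'b pair_pre_digraph \<Rightarrow> ('a \<times> 'b) pair_pre_digraph" where
  "cartesian_product G H = \<lparr>
     pverts = pverts G \<times> pverts H,
     parcs = {((a, b), (c, d)) | a b c d.
        (a = c \<and> a \<in> pverts G \<and> (b, d) \<in> parcs H) \<or>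
        ((a, c) \<in> parcs G \<and> b = d \<and> b \<in> pverts H)} \<rparr>"

definition grid :: "nat \<Rightarrow> (nat \<times> nat) pair_pre_digraph" where
  "grid n = cartesian_product (complete_graph n) (complete_graph n)"

definition locally_grid :: "nat \<Rightarrow> 'a pair_pre_digraph \<Rightarrow> bool" where
  "locally_grid n G \<longleftrightarrow>
     (\<forall>x \<in> pverts G. digraph_iso (with_proj G \<restriction> neighbourhood G x) (with_proj (grid n)))"

text \<open>The global name of connectedness is qualified because topology has a \<open>connected\<close> too.\<close>

definition connected_locally_grid :: "nat \<Rightarrow> 'a pair_pre_digraph \<Rightarrow> bool" where
  "connected_locally_grid n G \<longleftrightarrow>
     pair_graph G \<and> Digraph_Component.connected (with_proj G) \<and> locally_grid n G"

definition mu_graph :: "'a pair_pre_digraph \<Rightarrow> 'a \<Rightarrow> 'a \<Rightarrow> ('a, 'a \<times> 'a) pre_digraph" where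
  "mu_graph G x y = with_proj G \<restriction> (neighbourhood G x \<inter> neighbourhood G y)"

definition mu_orders :: "'a pair_pre_digraph \<Rightarrow> nat set" where
  "mu_orders G =
     {card (verts (mu_graph G x y)) | x y. x \<in> pverts G \<and> y \<in> pverts G \<and> graph_dist G x y = 2}"

text \<open>
  The intersection array \<open>(b\<^sub>0, \<dots>, b\<^bsub>D-1\<^esub>; c\<^sub>1, \<dots>, c\<^sub>D)\<close> is given by two lists; since lists are
  indexed from 0, \<open>c\<^sub>i\<close> is the entry \<open>cs ! (i - 1)\<close>.
\<close>

definition distance_regular :: "'a pair_pre_digraph \<Rightarrow> nat list \<Rightarrow> nat list \<Rightarrow> bool" where
  "distance_regular G bs cs \<longleftrightarrow>
     pair_graph G \<and> Digraph_Component.connected (with_proj G) \<and>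
     length bs = diameter G \<and> length cs = diameter G \<and>
     (\<forall>x \<in> pverts G. \<forall>y \<in> pverts G. \<forall>i. graph_dist G x y = i \<longrightarrow>
        (i < diameter G \<longrightarrow> card {z \<in> neighbourhood G y. graph_dist G x z = i + 1} = bs ! i) \<and>
        (1 \<le> i \<longrightarrow> card {z \<in> neighbourhood G y. graph_dist G x z = i - 1} = cs ! (i - 1)))"

definition antipodal_rel :: "'a pair_pre_digraph \<Rightarrow> 'a rel" where
  "antipodal_rel G =
     {(x, y). x \<in> pverts G \<and> y \<in> pverts G \<and> (x = y \<or> graph_dist G x y = 3)}"

definition quotient_graph :: "'a pair_pre_digraph \<Rightarrow> 'a rel \<Rightarrow> 'a set pair_pre_digraph" where
  "quotient_graph G R = \<lparr>
     pverts = pverts G // R,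
     parcs = {(A, B). A \<in> pverts G // R \<and> B \<in> pverts G // R \<and> A \<noteq> B \<and>
                (\<exists>x \<in> A. \<exists>y \<in> B. (x, y) \<in> parcs G)} \<rparr>"

definition antipodal_cover :: "nat \<Rightarrow> nat \<Rightarrow> 'a pair_pre_digraph \<Rightarrow> bool" where
  "antipodal_cover r N G \<longleftrightarrow>
     (\<exists>bs cs. distance_regular G bs cs) \<and> diameter G = 3 \<and>
     equiv (pverts G) (antipodal_rel G) \<and>
     (\<forall>B \<in> pverts G // antipodal_rel G. card B = r) \<and>
     complete_digraph N (with_proj (quotient_graph G (antipodal_rel G)))"

lemma complete_digraph_complete_graph: "complete_digraph n (with_proj (complete_graph n))"
  by (auto simp: complete_digraph_pair_def complete_graph_def)

lemma pverts_grid: "pverts (grid n) = {1..n} \<times> {1..n}"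
  by (simp add: grid_def cartesian_product_def complete_graph_def)

lemma parcs_grid_iff:
  "((i, j), (k, l)) \<in> parcs (grid n) \<longleftrightarrow>
     {i, j, k, l} \<subseteq> {1..n} \<and> (i = k) \<noteq> (j = l)"
  by (auto simp: grid_def cartesian_product_def complete_graph_def)

end

(*
  The neighbourhood of a vertex x is an n by n grid, and the common neighbours of x and a vertex y
  at distance 2 meet every row and every column of that grid in 0 or 2 vertices; hence the orders
  of mu-graphs are even, at least 4 and at most 2n.

  (1) If mu-graphs have order at least n - 1, a vertex z at distance at least 3 from x has at least
  ((n + 1)/2)^2 neighbours closer to x: they meet any row or column around z in 0 or at least
  (n + 1)/2 vertices. Rows and columns they meet contain no neighbour of z farther from x, so there
  are at most ((n - 1)/2)^2 of these, and the spheres around x eventually shrink geometrically.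

  (2) If mu-graphs have order at least 2(n - 1), a vertex at distance 2 has at most one neighbour at
  distance 3, and all neighbours of a vertex at distance 3 are at distance 2. Counting edges between
  spheres gives the bound on the order, strict if some mu-graph has order 2n.

  (3) If all mu-graphs have order 2(n - 1), "equal or at distance 3" is an equivalence relation with
  classes of a constant size r, 2r <= n + 1, and any two antipodal classes joined by an edge are
  joined by a perfect matching. The quotient graph is regular of degree n^2 and any two of its
  vertices have 2(n - 1)r common neighbours, so counting closed walks of prime length p shows that a
  prime p dividing n^2 - 2(n - 1)r divides n. Counting edges leaving a clique of order n + 1 gives
  2r | n(n + 1). For odd n these conditions force 2r = n + 1, which makes the quotient complete.
  For even n the quotient is not complete, so some clique of order n + 1 lies at distance 2 from some
  vertex; the mu-graphs then induce a perfect matching on the clique, contradicting that n + 1 is odd.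
*)

theory Submission
  imports Defs "HOL-Number_Theory.Cong"
begin

section \<open>Locally grid graphs in coordinates\<close>

text \<open>The coordinates \<open>rw x\<close> and \<open>cl x\<close> come from a grid isomorphism
  chosen separately at each vertex \<open>x\<close>; nothing relates the choices at different
  vertices. The distance \<open>d\<close> enters through the metric axioms, its value 1 on edges and
  the existence of predecessors on geodesics.\<close>

locale local_grid =
  fixes V :: "'a set" and adj :: "'a \<Rightarrow> 'a \<Rightarrow> bool" and n :: nat
    and d :: "'a \<Rightarrow> 'a \<Rightarrow> nat" and rw cl :: "'a \<Rightarrow> 'a \<Rightarrow> nat"
  assumes finite_V: "finite V"
    and V_nonempty: "V \<noteq> {}"
    and n_ge_2: "2 \<le> n"
    and adj_in_V: "adj x y \<Longrightarrow> x \<in> V"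
    and adj_sym: "adj x y \<Longrightarrow> adj y x"
    and adj_irrefl: "\<not> adj x x"
    and grid_bij: "x \<in> V \<Longrightarrow> bij_betw (\<lambda>s. (rw x s, cl x s)) {s. adj x s} ({1..n} \<times> {1..n})"
    and grid_adj: "adj x s \<Longrightarrow> adj x t \<Longrightarrow> adj s t \<longleftrightarrow> (rw x s = rw x t) \<noteq> (cl x s = cl x t)"
    and d_eq_0: "x \<in> V \<Longrightarrow> y \<in> V \<Longrightarrow> d x y = 0 \<longleftrightarrow> x = y"
    and d_sym: "x \<in> V \<Longrightarrow> y \<in> V \<Longrightarrow> d x y = d y x"
    and d_triangle: "x \<in> V \<Longrightarrow> y \<in> V \<Longrightarrow> z \<in> V \<Longrightarrow> d x z \<le> d x y + d y z"
    and d_pred: "x \<in> V \<Longrightarrow> y \<in> V \<Longrightarrow> d x y = Suc i \<Longrightarrow> \<exists>z. adj z y \<and> d x z = i"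
    and d_adj: "adj x y \<Longrightarrow> d x y = 1"
begin

text \<open>Exchanging rows with columns preserves the hypotheses, so each lemma about rows yields
  its mirror image about columns.\<close>

lemma swap: "local_grid V adj n d cl rw"
proof (unfold_locales)
  fix x assume x: "x \<in> V"
  have "bij_betw (prod.swap \<circ> (\<lambda>s. (rw x s, cl x s))) {s. adj x s} ({1..n} \<times> {1..n})"
    by (rule bij_betw_trans[OF grid_bij[OF x]])
      (auto simp: bij_betw_def product_swap)
  then show "bij_betw (\<lambda>s. (cl x s, rw x s)) {s. adj x s} ({1..n} \<times> {1..n})"
    by (simp add: comp_def)
next
  fix x s t assume "adj x s" "adj x t"
  then show "adj s t = ((cl x s = cl x t) \<noteq> (rw x s = rw x t))" using grid_adj by blast
qed (fact finite_V V_nonempty n_ge_2 adj_in_V adj_sym adj_irrefl d_eq_0 d_sym d_triangle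
      d_pred d_adj)+

lemma adj_in_V': "adj x y \<Longrightarrow> y \<in> V"
  using adj_in_V adj_sym by blast

definition nb :: "'a \<Rightarrow> 'a set" where "nb x = {s. adj x s}"

definition cn :: "'a \<Rightarrow> 'a \<Rightarrow> 'a set" where "cn x y = nb x \<inter> nb y"

lemma nb_subset: "nb x \<subseteq> V"
  by (auto simp: nb_def adj_in_V')

lemma finite_nb [simp]: "finite (nb x)"
  using finite_subset[OF nb_subset finite_V] .

lemma finite_cn [simp]: "finite (cn x y)"
  by (simp add: cn_def)

lemma cn_commute: "cn x y = cn y x"
  by (auto simp: cn_def)

lemma d_1_adj: "x \<in> V \<Longrightarrow> y \<in> V \<Longrightarrow> d x y = 1 \<longleftrightarrow> adj x y"
proof
  assume xy: "x \<in> V" "y \<in> V" and "d x y = 1"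
  then obtain z where "adj z y" "d x z = 0" using d_pred[of x y 0] by auto
  then show "adj x y" using xy d_eq_0 adj_in_V by blast
qed (simp add: d_adj)

lemma d_step: "adj y z \<Longrightarrow> x \<in> V \<Longrightarrow> d x z \<le> Suc (d x y)"
  using d_triangle[of x y z] d_adj[of y z] adj_in_V adj_in_V' by fastforce

lemma coords_range:
  assumes "adj x s" shows "rw x s \<in> {1..n}" "cl x s \<in> {1..n}"
proof -
  have "(\<lambda>s. (rw x s, cl x s)) s \<in> {1..n} \<times> {1..n}"
    using bij_betw_imp_surj_on[OF grid_bij[OF adj_in_V[OF assms]]] assms by blast
  then show "rw x s \<in> {1..n}" "cl x s \<in> {1..n}" by auto
qed

lemma coords_inj:
  assumes "adj x s" "adj x t" "rw x s = rw x t" "cl x s = cl x t" shows "s = t"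
  using inj_onD[OF bij_betw_imp_inj_on[OF grid_bij[OF adj_in_V[OF assms(1)]]], of s t] assms by auto

lemma coords_ex:
  assumes "x \<in> V" "a \<in> {1..n}" "b \<in> {1..n}"
  obtains s where "adj x s" "rw x s = a" "cl x s = b"
proof -
  have "(a, b) \<in> (\<lambda>s. (rw x s, cl x s)) ` {s. adj x s}"
    using bij_betw_imp_surj_on[OF grid_bij[OF assms(1)]] assms by blast
  then show ?thesis using that by auto
qed

lemma card_coords:
  assumes "x \<in> V"
  shows "card {s \<in> nb x. P (rw x s) (cl x s)} = card {(a, b). a \<in> {1..n} \<and> b \<in> {1..n} \<and> P a b}"
proof (rule bij_betw_same_card)
  show "bij_betw (\<lambda>s. (rw x s, cl x s)) {s \<in> nb x. P (rw x s) (cl x s)}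
      {(a, b). a \<in> {1..n} \<and> b \<in> {1..n} \<and> P a b}"
    unfolding bij_betw_def
  proof
    show "inj_on (\<lambda>s. (rw x s, cl x s)) {s \<in> nb x. P (rw x s) (cl x s)}"
      by (auto simp: inj_on_def nb_def intro: coords_inj)
    show "(\<lambda>s. (rw x s, cl x s)) ` {s \<in> nb x. P (rw x s) (cl x s)} =
        {(a, b). a \<in> {1..n} \<and> b \<in> {1..n} \<and> P a b}" (is "?L = ?R")
    proof
      show "?L \<subseteq> ?R" using coords_range by (auto simp: nb_def)
      show "?R \<subseteq> ?L"
      proof
        fix p assume "p \<in> ?R"
        then obtain a b where ab: "p = (a, b)" "a \<in> {1..n}" "b \<in> {1..n}" "P a b" by auto
        obtain s where "adj x s" "rw x s = a" "cl x s = b" using coords_ex[OF assms ab(2,3)] .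
        then show "p \<in> ?L" using ab by (auto simp: nb_def intro!: image_eqI[of _ _ s])
      qed
    qed
  qed
qed

lemma card_nb: "x \<in> V \<Longrightarrow> card (nb x) = n ^ 2"
  using bij_betw_same_card[OF grid_bij[of x]]
  by (simp add: nb_def power2_eq_square)

lemma card_row:
  assumes "x \<in> V" "a \<in> {1..n}" shows "card {s \<in> nb x. rw x s = a} = n"
proof -
  have "{(a', b). a' \<in> {1..n} \<and> b \<in> {1..n} \<and> a' = a} = {a} \<times> {1..n}" using assms by auto
  then show ?thesis using card_coords[OF assms(1), of "\<lambda>a' _. a' = a"] by simp
qed

text \<open>In the grid around \<open>s\<close> the vertex \<open>x\<close> is a single cell, and
  the vertices counted are the cells outside both its row and its column.\<close>

lemma card_nonadj:
  assumes "adj x s" shows "card {t \<in> nb s. t \<noteq> x \<and> \<not> adj x t} = (n - 1) ^ 2"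
proof -
  have sx: "adj s x" and sV: "s \<in> V" using assms adj_sym adj_in_V' by auto
  have "{t \<in> nb s. t \<noteq> x \<and> \<not> adj x t} = {t \<in> nb s. rw s t \<noteq> rw s x \<and> cl s t \<noteq> cl s x}"
  proof (rule Collect_cong)
    fix t
    show "t \<in> nb s \<and> t \<noteq> x \<and> \<not> adj x t \<longleftrightarrow> t \<in> nb s \<and> rw s t \<noteq> rw s x \<and> cl s t \<noteq> cl s x"
    proof (cases "adj s t")
      case True
      then show ?thesis using grid_adj[OF sx True] coords_inj[OF sx True] by (auto simp: nb_def)
    qed (simp add: nb_def)
  qed
  moreover have "{(a, b). a \<in> {1..n} \<and> b \<in> {1..n} \<and> a \<noteq> rw s x \<and> b \<noteq> cl s x} =
      ({1..n} - {rw s x}) \<times> ({1..n} - {cl s x})" by auto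
  ultimately show ?thesis
    using card_coords[OF sV, of "\<lambda>a b. a \<noteq> rw s x \<and> b \<noteq> cl s x"] coords_range[OF sx]
    by (simp add: card_cartesian_product power2_eq_square)
qed

lemma card_cn_adj:
  assumes "adj x s" shows "card (cn x s) = 2 * (n - 1)"
proof -
  have sx: "adj s x" and sV: "s \<in> V" using assms adj_sym adj_in_V' by auto
  have "cn x s = {t \<in> nb s. (rw s t = rw s x) \<noteq> (cl s t = cl s x)}"
    using grid_adj[OF sx] by (auto simp: nb_def cn_def)
  moreover have "{(a, b). a \<in> {1..n} \<and> b \<in> {1..n} \<and> (a = rw s x) \<noteq> (b = cl s x)} =
      {rw s x} \<times> ({1..n} - {cl s x}) \<union> ({1..n} - {rw s x}) \<times> {cl s x}"
    using coords_range[OF sx] by auto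
  moreover have "card ({rw s x} \<times> ({1..n} - {cl s x}) \<union> ({1..n} - {rw s x}) \<times> {cl s x})
      = (n - 1) + (n - 1)"
    using coords_range[OF sx] by (subst card_Un_disjoint) (auto simp: card_cartesian_product)
  ultimately show ?thesis
    using card_coords[OF sV, of "\<lambda>a b. (a = rw s x) \<noteq> (b = cl s x)"]
    by simp
qed

text \<open>In the grid around a common neighbour \<open>s\<close>, the nonadjacent vertices \<open>x\<close> and \<open>y\<close> are opposite
  corners of a rectangle; the other two corners are nonadjacent, so in the grid around \<open>x\<close> one of
  them lies in the row of \<open>s\<close> and the other in its column.\<close>

lemma card_cn_row:
  assumes xV: "x \<in> V" and yV: "y \<in> V" and d2: "d x y = 2" and s: "s \<in> cn x y"
  shows "card {t \<in> cn x y. rw x t = rw x s} = 2"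
proof -
  have sx: "adj s x" and sy: "adj s y" and xs: "adj x s" and sV: "s \<in> V"
    using s adj_sym adj_in_V' by (auto simp: cn_def nb_def)
  have xy: "x \<noteq> y" "\<not> adj x y" using d2 d_eq_0[OF xV yV] d_1_adj[OF xV yV] by auto
  have neq: "rw s x \<noteq> rw s y" "cl s x \<noteq> cl s y"
    using grid_adj[OF sx sy] coords_inj[OF sx sy] xy by auto
  obtain p where p: "adj s p" "rw s p = rw s x" "cl s p = cl s y"
    using coords_ex[OF sV coords_range(1)[OF sx] coords_range(2)[OF sy]] .
  obtain q where q: "adj s q" "rw s q = rw s y" "cl s q = cl s x"
    using coords_ex[OF sV coords_range(1)[OF sy] coords_range(2)[OF sx]] .
  have common: "t = p \<or> t = q" if "adj s t" "adj x t" "adj y t" for t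
  proof -
    have "(rw s x = rw s t) \<noteq> (cl s x = cl s t)" "(rw s y = rw s t) \<noteq> (cl s y = cl s t)"
      using grid_adj[OF sx that(1)] grid_adj[OF sy that(1)] that by auto
    then have "rw s t = rw s x \<and> cl s t = cl s y \<or> rw s t = rw s y \<and> cl s t = cl s x"
      using neq by auto
    then show ?thesis
      using coords_inj[OF that(1) p(1)] coords_inj[OF that(1) q(1)] p q by auto
  qed
  have pcn: "adj x p" "adj y p" and qcn: "adj x q" "adj y q"
    using grid_adj[OF sx p(1)] grid_adj[OF sy p(1)] grid_adj[OF sx q(1)] grid_adj[OF sy q(1)] p q neq
    by auto
  have pq: "p \<noteq> q" "\<not> adj p q" using grid_adj[OF p(1) q(1)] p q neq by auto
  have "rw x p \<noteq> rw x q" "cl x p \<noteq> cl x q"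
    using grid_adj[OF pcn(1) qcn(1)] coords_inj[OF pcn(1) qcn(1)] pq by auto
  moreover have "(rw x s = rw x p) \<noteq> (cl x s = cl x p)" "(rw x s = rw x q) \<noteq> (cl x s = cl x q)"
    using grid_adj[OF xs pcn(1)] grid_adj[OF xs qcn(1)] p q by auto
  ultimately obtain u where u: "u = p \<or> u = q" "rw x u = rw x s" "\<And>v. v = p \<or> v = q \<Longrightarrow> rw x v = rw x s \<Longrightarrow> v = u"
    by metis
  have "{t \<in> cn x y. rw x t = rw x s} = {s, u}"
  proof (intro equalityI subsetI)
    fix t assume "t \<in> {t \<in> cn x y. rw x t = rw x s}"
    then have t: "adj x t" "adj y t" "rw x t = rw x s" by (auto simp: cn_def nb_def)
    show "t \<in> {s, u}"
    proof (cases "t = s")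
      case False
      then have "adj s t" using grid_adj[OF xs t(1)] coords_inj[OF xs t(1)] t by auto
      then show ?thesis using common u t by blast
    qed simp
  next
    fix t assume "t \<in> {s, u}"
    moreover have "u \<in> cn x y" using u(1) pcn qcn by (auto simp: cn_def nb_def)
    ultimately show "t \<in> {t \<in> cn x y. rw x t = rw x s}" using u(2) s by auto
  qed
  moreover have "s \<noteq> u" using u p q adj_irrefl by blast
  ultimately show ?thesis by simp
qed

lemma card_cn_eq_rows:
  assumes "x \<in> V" "y \<in> V" "d x y = 2"
  shows "card (cn x y) = 2 * card (rw x ` cn x y)"
proof -
  have "card (cn x y) = (\<Sum>a\<in>rw x ` cn x y. card {t \<in> cn x y. rw x t = a})"
    using sum.image_gen[OF finite_cn, of "\<lambda>_. 1::nat" x y "rw x"] by simp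
  also have "\<dots> = (\<Sum>a\<in>rw x ` cn x y. 2)"
    by (rule sum.cong) (use card_cn_row[OF assms] in auto)
  finally show ?thesis by simp
qed

lemma card_cn_eq_cols:
  assumes "x \<in> V" "y \<in> V" "d x y = 2"
  shows "card (cn x y) = 2 * card (cl x ` cn x y)"
  using local_grid.card_cn_eq_rows[OF swap assms] .

lemma cn_nonempty: "x \<in> V \<Longrightarrow> y \<in> V \<Longrightarrow> d x y = 2 \<Longrightarrow> cn x y \<noteq> {}"
proof -
  assume xy: "x \<in> V" "y \<in> V" "d x y = 2"
  then obtain s where "adj s y" "d x s = 1" using d_pred[of x y 1] by auto
  then have "s \<in> cn x y" using d_1_adj[of x s] xy adj_in_V adj_sym by (auto simp: cn_def nb_def)
  then show ?thesis by blast
qed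

lemma rw_cn_subset: "rw x ` cn x y \<subseteq> {1..n}"
  using coords_range by (auto simp: cn_def nb_def)

lemma cl_cn_subset: "cl x ` cn x y \<subseteq> {1..n}"
  using coords_range by (auto simp: cn_def nb_def)

lemma mu_bounds:
  assumes "x \<in> V" "y \<in> V" "d x y = 2"
  shows "even (card (cn x y))" "4 \<le> card (cn x y)" "card (cn x y) \<le> 2 * n"
proof -
  show "even (card (cn x y))" using card_cn_eq_rows[OF assms] by simp
  have "card (rw x ` cn x y) \<le> n" using card_mono[OF _ rw_cn_subset] by simp
  then show "card (cn x y) \<le> 2 * n" using card_cn_eq_rows[OF assms] by simp
  obtain s where s: "s \<in> cn x y" using cn_nonempty[OF assms] by blast
  \<comment> \<open>The two common neighbours in one row have different columns, so at least two
    columns are met, each of them twice.\<close>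
  have "inj_on (cl x) {t \<in> cn x y. rw x t = rw x s}"
    by (auto simp: inj_on_def cn_def nb_def intro: coords_inj)
  then have "card (cl x ` {t \<in> cn x y. rw x t = rw x s}) = 2"
    by (simp only: card_image card_cn_row[OF assms s])
  moreover have "cl x ` {t \<in> cn x y. rw x t = rw x s} \<subseteq> cl x ` cn x y" by auto
  ultimately have "2 \<le> card (cl x ` cn x y)"
    using card_mono[of "cl x ` cn x y" "cl x ` {t \<in> cn x y. rw x t = rw x s}"] by simp
  then show "4 \<le> card (cn x y)" using card_cn_eq_cols[OF assms] by simp
qed

end

section \<open>Spheres and the case of orders at least \<open>n - 1\<close>\<close>

context local_grid
begin

definition sph :: "'a \<Rightarrow> nat \<Rightarrow> 'a set" where "sph x i = {y \<in> V. d x y = i}"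

lemma finite_sph [simp]: "finite (sph x i)"
  using finite_V by (simp add: sph_def)

lemma sph_0: "x \<in> V \<Longrightarrow> sph x 0 = {x}"
  by (auto simp: sph_def d_eq_0)

lemma sph_1: "x \<in> V \<Longrightarrow> sph x 1 = nb x"
  using d_1_adj adj_in_V' by (auto simp: sph_def nb_def)

lemma card_V_sph:
  assumes "\<And>y. y \<in> V \<Longrightarrow> d x y < m"
  shows "card V = (\<Sum>i<m. card (sph x i))"
proof -
  have "V = (\<Union>i\<in>{..<m}. sph x i)" using assms by (auto simp: sph_def)
  also have "card \<dots> = (\<Sum>i<m. card (sph x i))"
    by (rule card_UN_disjoint) (auto simp: sph_def finite_V)
  finally show ?thesis .
qed

text \<open>Double counting of the edges between the neighbours of \<open>x\<close> and the vertices
  at distance 2; \<open>card_nonadj\<close> gives the number at each neighbour.\<close>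

lemma sum_cn: "x \<in> V \<Longrightarrow> (\<Sum>y\<in>sph x 2. card (cn x y)) = n ^ 2 * (n - 1) ^ 2"
proof -
  assume x: "x \<in> V"
  have "(\<Sum>y\<in>sph x 2. card {s \<in> nb x. adj s y}) = (\<Sum>s\<in>nb x. (n - 1) ^ 2)"
  proof (rule sum_multicount_gen; (intro ballI)?)
    fix s assume "s \<in> nb x"
    then have s: "adj x s" by (simp add: nb_def)
    have "{y \<in> sph x 2. adj s y} = {t \<in> nb s. t \<noteq> x \<and> \<not> adj x t}"
    proof (rule Set.set_eqI)
      fix t
      show "t \<in> {y \<in> sph x 2. adj s y} \<longleftrightarrow> t \<in> {t \<in> nb s. t \<noteq> x \<and> \<not> adj x t}"
      proof (cases "adj s t")
        case True
        then have t: "t \<in> V" by (rule adj_in_V')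
        have "d x t \<le> 2" using d_step[OF True x] d_adj[OF s] by simp
        then have "d x t = 2 \<longleftrightarrow> d x t \<noteq> 0 \<and> d x t \<noteq> 1" by auto
        then show ?thesis using True t d_eq_0[OF x t] d_1_adj[OF x t] by (auto simp: sph_def nb_def)
      qed (auto simp: nb_def)
    qed
    then show "card {y \<in> sph x 2. adj s y} = (n - 1) ^ 2" using card_nonadj[OF s] by simp
  qed auto
  moreover have "{s \<in> nb x. adj s y} = cn x y" for y using adj_sym by (auto simp: cn_def nb_def)
  ultimately show ?thesis using card_nb[OF x] by simp
qed

text \<open>In a distance-regular graph the sizes of \<open>prv x y\<close> and of
  \<open>nxt x y\<close> below are the intersection numbers c and b. Writing \<open>Suc\<close>
  avoids a truncated subtraction at distance 0.\<close>

definition prv :: "'a \<Rightarrow> 'a \<Rightarrow> 'a set" where "prv x y = {z \<in> nb y. Suc (d x z) = d x y}"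

definition nxt :: "'a \<Rightarrow> 'a \<Rightarrow> 'a set" where "nxt x y = {z \<in> nb y. d x z = Suc (d x y)}"

lemma finite_prv [simp]: "finite (prv x y)" by (simp add: prv_def)

lemma sum_nxt_prv:
  "(\<Sum>y\<in>sph x i. card (nxt x y)) = (\<Sum>z\<in>sph x (Suc i). card (prv x z))"
proof -
  have "card (nxt x y) = card {z \<in> sph x (Suc i). adj y z}" if "y \<in> sph x i" for y
    using that adj_in_V' by (intro arg_cong[of _ _ card]) (auto simp: nxt_def sph_def nb_def)
  then have "(\<Sum>y\<in>sph x i. card (nxt x y)) = (\<Sum>y\<in>sph x i. card {z \<in> sph x (Suc i). adj y z})"
    by simp
  also have "\<dots> = (\<Sum>z\<in>sph x (Suc i). card {y \<in> sph x i. adj y z})"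
    by (rule sum_multicount_gen) auto
  also have "\<dots> = (\<Sum>z\<in>sph x (Suc i). card (prv x z))"
    by (rule sum.cong, simp, rule arg_cong[of _ _ card])
      (auto simp: prv_def sph_def nb_def intro: adj_sym adj_in_V)
  finally show ?thesis .
qed

lemma prv_2:
  assumes "x \<in> V" "d x y = 2" shows "prv x y = cn x y"
  using d_1_adj[OF assms(1)] adj_in_V' assms(2) by (auto simp: prv_def cn_def nb_def d_adj)

text \<open>Two vertices in one row are equal or adjacent, but the distances of \<open>t\<close> and
  \<open>p\<close> from \<open>x\<close> differ by 2.\<close>

lemma nxt_row_disjoint:
  assumes x: "x \<in> V" and t: "t \<in> nxt x z" and p: "p \<in> prv x z"
  shows "rw z t \<noteq> rw z p"
proof
  assume eq: "rw z t = rw z p"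
  have zt: "adj z t" "d x t = Suc (d x z)" and zp: "adj z p" "Suc (d x p) = d x z"
    using t p by (auto simp: nxt_def prv_def nb_def)
  then have "p \<noteq> t" by auto
  then have "adj p t" using grid_adj[OF zp(1) zt(1)] coords_inj[OF zp(1) zt(1)] eq by auto
  then show False using d_step[of p t x] x zt(2) zp(2) by simp
qed

lemma nxt_col_disjoint:
  assumes "x \<in> V" "t \<in> nxt x z" "p \<in> prv x z"
  shows "cl z t \<noteq> cl z p"
  using local_grid.nxt_row_disjoint[OF swap assms] .

text \<open>The rows and columns of \<open>nxt x z\<close> avoid those of \<open>prv x z\<close>, so
  in coordinates \<open>nxt x z\<close> lies in the product of the two complements.\<close>

lemma card_nxt_le:
  assumes x: "x \<in> V" and z: "z \<in> V"
  shows "card (nxt x z) \<le> (n - card (rw z ` prv x z)) * (n - card (cl z ` prv x z))"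
proof -
  let ?A = "{1..n} - rw z ` prv x z" and ?B = "{1..n} - cl z ` prv x z"
  have adj: "adj z t" if "t \<in> nxt x z \<or> t \<in> prv x z" for t
    using that by (auto simp: nxt_def prv_def nb_def)
  have "inj_on (\<lambda>t. (rw z t, cl z t)) (nxt x z)"
    using adj by (auto simp: inj_on_def intro: coords_inj)
  moreover have "(\<lambda>t. (rw z t, cl z t)) ` nxt x z \<subseteq> ?A \<times> ?B"
  proof
    fix c assume "c \<in> (\<lambda>t. (rw z t, cl z t)) ` nxt x z"
    then obtain t where t: "t \<in> nxt x z" "c = (rw z t, cl z t)" by blast
    have "rw z t \<notin> rw z ` prv x z" "cl z t \<notin> cl z ` prv x z"
      using nxt_row_disjoint[OF x t(1)] nxt_col_disjoint[OF x t(1)] by blast+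
    then show "c \<in> ?A \<times> ?B" using t coords_range[OF adj[of t]] by auto
  qed
  ultimately have "card (nxt x z) \<le> card (?A \<times> ?B)" by (intro card_inj_on_le) auto
  moreover have "rw z ` prv x z \<subseteq> {1..n}" "cl z ` prv x z \<subseteq> {1..n}"
    using coords_range adj by auto
  ultimately show ?thesis by (simp add: card_cartesian_product card_Diff_subset)
qed

text \<open>A member outside the row of \<open>y\<close> shares its column, and one outside the
  column shares its row; two such members would differ in both coordinates and be
  nonadjacent.\<close>

lemma clique_line:
  assumes K: "K \<subseteq> nb z" and adj: "\<And>p q. p \<in> K \<Longrightarrow> q \<in> K \<Longrightarrow> p \<noteq> q \<Longrightarrow> adj p q" and y: "y \<in> K"
  shows "(\<forall>p\<in>K. rw z p = rw z y) \<or> (\<forall>p\<in>K. cl z p = cl z y)"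
proof (rule ccontr)
  assume "\<not> ?thesis"
  then obtain p q where pq: "p \<in> K" "q \<in> K" "rw z p \<noteq> rw z y" "cl z q \<noteq> cl z y" by blast
  have z: "adj z p" "adj z q" "adj z y" using K pq y by (auto simp: nb_def)
  have "cl z p = cl z y" using adj[of p y] pq y grid_adj[OF z(1,3)] by fastforce
  moreover have "rw z q = rw z y" using adj[of q y] pq y grid_adj[OF z(2,3)] by fastforce
  moreover have "p = q \<or> adj p q" using adj pq by blast
  ultimately show False using pq grid_adj[OF z(1,2)] by fastforce
qed

text \<open>The vertices of \<open>prv x z\<close> in the row or column of \<open>y\<close> around \<open>z\<close> are seen in the grid around
  \<open>y\<close>: they contain the intersection of the column of \<open>z\<close> there with the rows met by the
  \<open>\<mu>\<close>-graph of \<open>y\<close> and a vertex \<open>x'\<close> on a geodesic to \<open>x\<close>; similarly for the row of \<open>z\<close>.\<close>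

lemma prv_lines:
  assumes mu: "\<And>x y. x \<in> V \<Longrightarrow> y \<in> V \<Longrightarrow> d x y = 2 \<Longrightarrow> n - 1 \<le> card (cn x y)"
    and x: "x \<in> V" and z: "z \<in> V" and i: "3 \<le> d x z" and y: "y \<in> prv x z"
  shows "n + 1 \<le> 2 * card {p \<in> prv x z. rw z p = rw z y} \<and>
    n + 1 \<le> 2 * card {p \<in> prv x z. cl z p = cl z y}"
proof -
  obtain i where i: "d x z = i + 3" using \<open>3 \<le> d x z\<close> by (metis add.commute le_Suc_ex)
  have zy: "adj z y" "d x y = Suc (Suc i)" and yz: "adj y z" and yV: "y \<in> V"
    using y i adj_sym adj_in_V' by (auto simp: prv_def nb_def)
  \<comment> \<open>\<open>w\<close> and \<open>x'\<close> continue a geodesic from \<open>y\<close>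
    towards \<open>x\<close>, so \<open>x'\<close> is at distance 2 from \<open>y\<close> and at
    least 3 from \<open>z\<close>.\<close>
  obtain w where w: "adj w y" "d x w = Suc i" using d_pred[OF x yV zy(2)] by auto
  have wV: "w \<in> V" using w adj_in_V by auto
  obtain x' where x': "adj x' w" "d x x' = i" using d_pred[OF x wV w(2)] by auto
  have x'V: "x' \<in> V" using x' adj_in_V by auto
  have d2: "d x' y = 2"
    using d_triangle[OF x x'V yV] d_step[OF w(1) x'V] d_adj[OF x'(1)] x'(2) zy(2) by simp
  have d3: "3 \<le> d x' z" using d_triangle[OF x x'V z] i x'(2) by simp
  let ?S = "cn y x'"
  \<comment> \<open>Since \<open>z\<close> is at distance at least 3 from \<open>x'\<close>, a
    common neighbour of \<open>y\<close> and \<open>x'\<close> is neither \<open>z\<close> nor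
    adjacent to \<open>z\<close>, so it shares no coordinate with \<open>z\<close> around
    \<open>y\<close>.\<close>
  have S: "adj y s \<and> d x s \<le> Suc i \<and> rw y s \<noteq> rw y z \<and> cl y s \<noteq> cl y z" if s: "s \<in> ?S" for s
  proof -
    have s: "adj y s" "adj x' s" using s by (auto simp: cn_def nb_def)
    have "d x' z \<noteq> 1" "d x' z \<le> 2 \<Longrightarrow> False" using d3 by auto
    then have "s \<noteq> z" "\<not> adj s z" using d_adj[OF s(2)] d_step[of s z x'] x'V by auto
    then show ?thesis
      using s d_step[OF s(2) x] x'(2) grid_adj[OF s(1) yz] coords_inj[OF s(1) yz] by auto
  qed
  \<comment> \<open>Such a vertex \<open>p\<close> is at distance at most \<open>i + 2\<close> from
    \<open>x\<close> because of \<open>s\<close>, and at least \<open>i + 2\<close> because of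
    \<open>z\<close>.\<close>
  have inprv: "p \<in> prv x z" if p: "adj z p" "adj s p" "d x s \<le> Suc i" for p s
  proof -
    have "d x p \<le> Suc (Suc i)" using d_step[OF p(2) x] p(3) by simp
    moreover have "i + 3 \<le> Suc (d x p)" using d_step[OF adj_sym[OF p(1)] x] i by simp
    ultimately show ?thesis using p i by (simp add: prv_def nb_def)
  qed
  define K where "K = {p \<in> nb y. cl y p = cl y z \<and> rw y p \<in> rw y ` ?S}"
  define L where "L = {p \<in> nb y. rw y p = rw y z \<and> cl y p \<in> cl y ` ?S}"
  have K: "adj z p \<and> p \<in> prv x z" if "p \<in> K" for p
  proof -
    obtain s where s: "s \<in> ?S" "rw y p = rw y s" using \<open>p \<in> K\<close> by (auto simp: K_def)
    have p: "adj y p" "cl y p = cl y z" using \<open>p \<in> K\<close> by (auto simp: K_def nb_def)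
    have "adj z p" using grid_adj[OF yz p(1)] S[OF s(1)] s p by auto
    moreover have "adj s p" using grid_adj[of y s p] S[OF s(1)] s p by auto
    ultimately show ?thesis using inprv S[OF s(1)] by blast
  qed
  have L: "adj z p \<and> p \<in> prv x z" if "p \<in> L" for p
  proof -
    obtain s where s: "s \<in> ?S" "cl y p = cl y s" using \<open>p \<in> L\<close> by (auto simp: L_def)
    have p: "adj y p" "rw y p = rw y z" using \<open>p \<in> L\<close> by (auto simp: L_def nb_def)
    have "adj z p" using grid_adj[OF yz p(1)] S[OF s(1)] s p by auto
    moreover have "adj s p" using grid_adj[of y s p] S[OF s(1)] s p by auto
    ultimately show ?thesis using inprv S[OF s(1)] by blast
  qed
  have zr: "rw y z \<in> {1..n}" "cl y z \<in> {1..n}" using coords_range[OF yz] .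
  have "rw y ` K = rw y ` ?S"
  proof (intro equalityI subsetI)
    fix a assume a: "a \<in> rw y ` ?S"
    then have a': "a \<in> {1..n}" using rw_cn_subset by blast
    obtain p where "adj y p" "rw y p = a" "cl y p = cl y z" using coords_ex[OF yV a' zr(2)] .
    moreover from this have "p \<in> K" using a by (simp add: K_def nb_def)
    ultimately show "a \<in> rw y ` K" by blast
  qed (auto simp: K_def)
  then have cK: "card (rw y ` ?S) \<le> card K"
    using card_image_le[of K "rw y"] by (simp add: K_def)
  have "cl y ` L = cl y ` ?S"
  proof (intro equalityI subsetI)
    fix a assume a: "a \<in> cl y ` ?S"
    then have a': "a \<in> {1..n}" using cl_cn_subset by blast
    obtain p where "adj y p" "rw y p = rw y z" "cl y p = a" using coords_ex[OF yV zr(1) a'] .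
    moreover from this have "p \<in> L" using a by (simp add: L_def nb_def)
    ultimately show "a \<in> cl y ` L" by blast
  qed (auto simp: L_def)
  then have cL: "card (cl y ` ?S) \<le> card L"
    using card_image_le[of L "cl y"] by (simp add: L_def)
  have d2': "d y x' = 2" using d2 d_sym[OF x'V yV] by simp
  have muS: "n - 1 \<le> card ?S" using mu[OF yV x'V d2'] .
  have fin: "finite K" "finite L" by (auto simp: K_def L_def)
  have yKL: "y \<notin> K" "y \<notin> L" using adj_irrefl by (auto simp: K_def L_def nb_def)
  \<comment> \<open>\<open>K\<close> and \<open>L\<close> have at least (n - 1)/2 elements each;
    including \<open>y\<close> itself raises this to (n + 1)/2.\<close>
  have big: "n + 1 \<le> 2 * card (insert y K)" "n + 1 \<le> 2 * card (insert y L)"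
    using muS cK cL card_cn_eq_rows[OF yV x'V d2'] card_cn_eq_cols[OF yV x'V d2'] fin yKL n_ge_2
    by auto
  have lineK: "(\<forall>p\<in>insert y K. rw z p = rw z y) \<or> (\<forall>p\<in>insert y K. cl z p = cl z y)"
  proof (rule clique_line)
    show "insert y K \<subseteq> nb z" using K zy by (auto simp: nb_def)
    fix p q assume pq: "p \<in> insert y K" "q \<in> insert y K" "p \<noteq> q"
    show "adj p q"
    proof (cases "p = y \<or> q = y")
      case True
      then show ?thesis using pq adj_sym by (auto simp: K_def nb_def)
    next
      case False
      then have "adj y p" "adj y q" "cl y p = cl y q" using pq by (auto simp: K_def nb_def)
      then show ?thesis using grid_adj coords_inj pq(3) by blast
    qed
  qed simp
  have lineL: "(\<forall>p\<in>insert y L. rw z p = rw z y) \<or> (\<forall>p\<in>insert y L. cl z p = cl z y)"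
  proof (rule clique_line)
    show "insert y L \<subseteq> nb z" using L zy by (auto simp: nb_def)
    fix p q assume pq: "p \<in> insert y L" "q \<in> insert y L" "p \<noteq> q"
    show "adj p q"
    proof (cases "p = y \<or> q = y")
      case True
      then show ?thesis using pq adj_sym by (auto simp: L_def nb_def)
    next
      case False
      then have "adj y p" "adj y q" "rw y p = rw y q" using pq by (auto simp: L_def nb_def)
      then show ?thesis using grid_adj coords_inj pq(3) by blast
    qed
  qed simp
  have Sne: "?S \<noteq> {}" using cn_nonempty[OF yV x'V d2'] .
  obtain p q where pq: "p \<in> K" "q \<in> L"
    using Sne \<open>rw y ` K = rw y ` ?S\<close> \<open>cl y ` L = cl y ` ?S\<close> by blast
  \<comment> \<open>Nonadjacent \<open>p\<close> and \<open>q\<close> prevent the cliques containing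
    \<open>K\<close> and \<open>L\<close> from lying both in the row or both in the column of
    \<open>y\<close> around \<open>z\<close>; hence one lies in the row and the other in the
    column.\<close>
  have npq: "p \<noteq> q \<and> \<not> adj p q"
  proof -
    have p: "adj y p" "cl y p = cl y z" using pq by (auto simp: K_def nb_def)
    have q: "adj y q" "rw y q = rw y z" using pq by (auto simp: L_def nb_def)
    obtain s where "s \<in> ?S" "rw y p = rw y s" using pq by (auto simp: K_def)
    then have "rw y p \<noteq> rw y z" using S by metis
    moreover obtain t where "t \<in> ?S" "cl y q = cl y t" using pq by (auto simp: L_def)
    then have "cl y q \<noteq> cl y z" using S by metis
    ultimately
    show ?thesis using grid_adj[OF p(1) q(1)] p q by auto
  qed
  then have diff: "rw z p \<noteq> rw z q" "cl z p \<noteq> cl z q"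
    using grid_adj[of z p q] coords_inj[of z p q] K[OF pq(1)] L[OF pq(2)] by auto
  have le: "card (insert y K') \<le> card {p \<in> prv x z. f p = f y}"
    if "\<forall>p\<in>insert y K'. f p = f y" "\<And>p. p \<in> K' \<Longrightarrow> p \<in> prv x z" for K' and f :: "'a \<Rightarrow> nat"
    by (rule card_mono) (use that y in auto)
  from lineK lineL show ?thesis
  proof (elim disjE)
    assume "\<forall>p\<in>insert y K. rw z p = rw z y" "\<forall>p\<in>insert y L. cl z p = cl z y"
    then show ?thesis using le[of K "rw z"] le[of L "cl z"] K L big by force
  next
    assume "\<forall>p\<in>insert y K. cl z p = cl z y" "\<forall>p\<in>insert y L. rw z p = rw z y"
    then show ?thesis using le[of K "cl z"] le[of L "rw z"] K L big by force
  next
    assume "\<forall>p\<in>insert y K. rw z p = rw z y" "\<forall>p\<in>insert y L. rw z p = rw z y"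
    then show ?thesis using pq diff(1) by (metis insertI2)
  next
    assume "\<forall>p\<in>insert y K. cl z p = cl z y" "\<forall>p\<in>insert y L. cl z p = cl z y"
    then show ?thesis using pq diff(2) by (metis insertI2)
  qed
qed

text \<open>By \<open>prv_lines\<close> at least (n + 1)/2 rows and columns are met, and each row
  met contains at least (n + 1)/2 vertices; at most (n - 1)/2 rows and columns remain for
  \<open>nxt\<close>. The factor 4 clears the halves.\<close>

lemma prv_nxt_bounds:
  assumes mu: "\<And>x y. x \<in> V \<Longrightarrow> y \<in> V \<Longrightarrow> d x y = 2 \<Longrightarrow> n - 1 \<le> card (cn x y)"
    and x: "x \<in> V" and z: "z \<in> V" and i: "3 \<le> d x z"
  shows "(n + 1) ^ 2 \<le> 4 * card (prv x z)" "4 * card (nxt x z) \<le> (n - 1) ^ 2"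
proof -
  let ?P = "prv x z"
  obtain y where y: "y \<in> ?P"
    using d_pred[OF x z, of "d x z - 1"] i adj_sym by (fastforce simp: prv_def nb_def)
  have adj: "adj z p" if "p \<in> ?P" for p using that by (auto simp: prv_def nb_def)
  have line: "card {p \<in> ?P. rw z p = rw z y} \<le> card (cl z ` ?P)"
    by (rule card_inj_on_le[of "cl z"]) (auto simp: inj_on_def intro!: coords_inj[of z] adj)
  have line': "card {p \<in> ?P. cl z p = cl z y} \<le> card (rw z ` ?P)"
    by (rule card_inj_on_le[of "rw z"]) (auto simp: inj_on_def intro!: coords_inj[of z] adj)
  have R: "n + 1 \<le> 2 * card (rw z ` ?P)" and C: "n + 1 \<le> 2 * card (cl z ` ?P)"
    using prv_lines[OF mu x z i y] line line' by linarith+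
  have "card ?P = (\<Sum>a\<in>rw z ` ?P. card {p \<in> ?P. rw z p = a})"
    using sum.image_gen[OF finite_prv, of "\<lambda>_. 1::nat" x z "rw z"] by simp
  then have "2 * card ?P = (\<Sum>a\<in>rw z ` ?P. 2 * card {p \<in> ?P. rw z p = a})"
    by (simp add: sum_distrib_left)
  also have "\<dots> \<ge> (\<Sum>a\<in>rw z ` ?P. n + 1)"
  proof (rule sum_mono)
    fix a assume "a \<in> rw z ` ?P"
    then obtain p where p: "p \<in> ?P" "a = rw z p" by blast
    show "n + 1 \<le> 2 * card {p \<in> ?P. rw z p = a}"
      unfolding p(2) using prv_lines[OF mu x z i p(1)] by (rule conjunct1)
  qed
  also have "(\<Sum>a\<in>rw z ` ?P. n + 1) = card (rw z ` ?P) * (n + 1)" by (simp only: sum_constant of_nat_id)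
  finally have "2 * (card (rw z ` ?P) * (n + 1)) \<le> 4 * card ?P" by linarith
  moreover have "(n + 1) ^ 2 \<le> 2 * (card (rw z ` ?P) * (n + 1))"
    using mult_le_mono1[OF R, of "n + 1"] by (simp add: power2_eq_square)
  ultimately show "(n + 1) ^ 2 \<le> 4 * card ?P" by linarith
  have "4 * card (nxt x z) \<le> (2 * (n - card (rw z ` ?P))) * (2 * (n - card (cl z ` ?P)))"
    using card_nxt_le[OF x z] by simp
  also have "\<dots> \<le> (n - 1) * (n - 1)"
    by (rule mult_le_mono) (use R C n_ge_2 in linarith)+
  finally show "4 * card (nxt x z) \<le> (n - 1) ^ 2" by (simp add: power2_eq_square)
qed

section \<open>Growth of the spheres, and the bounds on order and diameter\<close>

lemma nxt_2_bound:
  assumes mu: "n - 1 \<le> card (cn x y)" and x: "x \<in> V" and y: "y \<in> V" and d2: "d x y = 2"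
  shows "4 * card (nxt x y) \<le> (n + 1) ^ 2"
proof -
  have dyx: "d y x = 2" using d2 d_sym[OF x y] by simp
  have P: "prv x y = cn y x" using prv_2[OF x d2] cn_commute by simp
  have m: "n - 1 \<le> card (cn y x)" using mu cn_commute by metis
  have "4 * card (nxt x y) \<le> (2 * (n - card (rw y ` cn y x))) * (2 * (n - card (cl y ` cn y x)))"
    using card_nxt_le[OF x y] P by simp
  also have "\<dots> \<le> (n + 1) * (n + 1)"
    by (rule mult_le_mono)
      (use m card_cn_eq_rows[OF y x dyx] card_cn_eq_cols[OF y x dyx] n_ge_2 in linarith)+
  finally show ?thesis by (simp add: power2_eq_square)
qed

text \<open>Edges between consecutive spheres are counted from both sides. From distance 2 to 3 the
  upper bound for farther neighbours and the lower bound for nearer ones are both (n + 1)^2/4, so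
  the sphere does not grow; from distance 3 on, \<open>prv_nxt_bounds\<close> gives the ratio ((n -
  1)/(n + 1))^2.\<close>

lemma sph_growth:
  assumes mu: "\<And>x y. x \<in> V \<Longrightarrow> y \<in> V \<Longrightarrow> d x y = 2 \<Longrightarrow> n - 1 \<le> card (cn x y)" and x: "x \<in> V"
  shows "card (sph x 2) \<le> n ^ 2 * (n - 1)" "card (sph x 3) \<le> card (sph x 2)"
    and "3 \<le> i \<Longrightarrow> (n + 1) ^ 2 * card (sph x (Suc i)) \<le> (n - 1) ^ 2 * card (sph x i)"
proof -
  have "(\<Sum>y\<in>sph x 2. n - 1) \<le> (\<Sum>y\<in>sph x 2. card (cn x y))"
    by (rule sum_mono) (use mu[OF x] in \<open>simp add: sph_def\<close>)
  then have "(n - 1) * card (sph x 2) \<le> (n - 1) * (n ^ 2 * (n - 1))"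
    unfolding sum_cn[OF x] by (simp add: power2_eq_square mult_ac)
  then show "card (sph x 2) \<le> n ^ 2 * (n - 1)" using n_ge_2 by simp
  have step: "a * card (sph x (Suc i)) \<le> b * card (sph x i)"
    if "\<And>y. y \<in> sph x i \<Longrightarrow> 4 * card (nxt x y) \<le> b"
      and "\<And>z. z \<in> sph x (Suc i) \<Longrightarrow> a \<le> 4 * card (prv x z)" for a b i
  proof -
    have "(\<Sum>z\<in>sph x (Suc i). a) \<le> (\<Sum>z\<in>sph x (Suc i). 4 * card (prv x z))"
      by (rule sum_mono) (rule that(2))
    also have "\<dots> = (\<Sum>y\<in>sph x i. 4 * card (nxt x y))"
      using sum_nxt_prv[of x i] by (simp flip: sum_distrib_left)
    also have "\<dots> \<le> (\<Sum>y\<in>sph x i. b)"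
      by (rule sum_mono) (rule that(1))
    finally show ?thesis by (simp add: mult.commute)
  qed
  have "(n + 1) ^ 2 * card (sph x (Suc 2)) \<le> (n + 1) ^ 2 * card (sph x 2)"
  proof (rule step)
    fix y assume "y \<in> sph x 2"
    then show "4 * card (nxt x y) \<le> (n + 1) ^ 2" using nxt_2_bound[of x y] mu[OF x, of y] x
      by (simp add: sph_def)
  next
    fix z assume "z \<in> sph x (Suc 2)"
    then have "z \<in> V" "3 \<le> d x z" by (auto simp: sph_def)
    then show "(n + 1) ^ 2 \<le> 4 * card (prv x z)" using prv_nxt_bounds(1)[OF mu x] by blast
  qed
  then have "card (sph x (Suc 2)) \<le> card (sph x 2)" by (subst (asm) mult_le_cancel1) simp
  then show "card (sph x 3) \<le> card (sph x 2)" by (simp add: eval_nat_numeral)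
  show "(n + 1) ^ 2 * card (sph x (Suc i)) \<le> (n - 1) ^ 2 * card (sph x i)" if i: "3 \<le> i"
  proof (rule step)
    fix y assume "y \<in> sph x i"
    then have "y \<in> V" "3 \<le> d x y" using i by (auto simp: sph_def)
    then show "4 * card (nxt x y) \<le> (n - 1) ^ 2" using prv_nxt_bounds(2)[OF mu x] by blast
  next
    fix z assume "z \<in> sph x (Suc i)"
    then have "z \<in> V" "3 \<le> d x z" using i by (auto simp: sph_def)
    then show "(n + 1) ^ 2 \<le> 4 * card (prv x z)" using prv_nxt_bounds(1)[OF mu x] by blast
  qed
qed

lemma sph_geometric:
  assumes mu: "\<And>x y. x \<in> V \<Longrightarrow> y \<in> V \<Longrightarrow> d x y = 2 \<Longrightarrow> n - 1 \<le> card (cn x y)" and x: "x \<in> V"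
  shows "real (card (sph x (3 + j))) \<le> real n ^ 2 * (real n - 1) * (((real n - 1) / (real n + 1)) ^ 2) ^ j"
proof (induction j)
  case 0
  have "card (sph x 3) \<le> n ^ 2 * (n - 1)"
    using sph_growth(2,1)[OF mu x] by (rule le_trans)
  then have "real (card (sph x 3)) \<le> real (n ^ 2 * (n - 1))" by (simp only: of_nat_le_iff)
  then show ?case using n_ge_2 by (simp add: of_nat_diff)
next
  case (Suc j)
  let ?q = "((real n - 1) / (real n + 1)) ^ 2"
  have "real ((n + 1) ^ 2 * card (sph x (Suc (3 + j)))) \<le> real ((n - 1) ^ 2 * card (sph x (3 + j)))"
    using sph_growth(3)[OF mu x, of "3 + j"] by (simp only: of_nat_le_iff le_add1)
  then have "(real n + 1) ^ 2 * real (card (sph x (Suc (3 + j)))) \<le> (real n - 1) ^ 2 * real (card (sph x (3 + j)))"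
    using n_ge_2 by (simp add: of_nat_diff add.commute)
  then have "real (card (sph x (Suc (3 + j)))) \<le> ?q * real (card (sph x (3 + j)))"
    by (simp add: field_simps power_divide)
  also have "\<dots> \<le> ?q * (real n ^ 2 * (real n - 1) * ?q ^ j)"
    by (rule mult_left_mono[OF Suc.IH]) simp
  finally show ?case by (simp add: mult_ac)
qed

lemma order_bound:
  assumes mu: "\<And>x y. x \<in> V \<Longrightarrow> y \<in> V \<Longrightarrow> d x y = 2 \<Longrightarrow> n - 1 \<le> card (cn x y)"
  shows "real (card V) \<le> real n ^ 3 * (real n + 5) / 4"
proof -
  obtain x where x: "x \<in> V" using V_nonempty by blast
  let ?N = "real n" and ?q = "((real n - 1) / (real n + 1)) ^ 2"
  have N: "2 \<le> ?N" using n_ge_2 by simp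
  define m where "m = Suc (Max (d x ` V))"
  have "d x y < 3 + m" if "y \<in> V" for y
  proof -
    have "d x y \<le> Max (d x ` V)" using finite_V that by (intro Max_ge) auto
    then show ?thesis by (simp add: m_def)
  qed
  then have "card V = (\<Sum>i<3 + m. card (sph x i))" by (rule card_V_sph)
  also have "3 + m = Suc (Suc (Suc m))" by simp
  also have "(\<Sum>i<Suc (Suc (Suc m)). card (sph x i)) =
      card (sph x 0) + card (sph x 1) + card (sph x 2) + (\<Sum>j<m. card (sph x (3 + j)))"
    unfolding sum.lessThan_Suc_shift by (simp add: eval_nat_numeral)
  finally have "card V = 1 + n ^ 2 + card (sph x 2) + (\<Sum>j<m. card (sph x (3 + j)))"
    by (simp only: sph_0[OF x] sph_1[OF x] card_nb[OF x]) simp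
  then have "real (card V) = 1 + ?N ^ 2 + real (card (sph x 2)) + (\<Sum>j<m. real (card (sph x (3 + j))))"
    by simp
  also have "(\<Sum>j<m. real (card (sph x (3 + j)))) \<le> (\<Sum>j<m. ?N ^ 2 * (?N - 1) * ?q ^ j)"
    by (rule sum_mono) (rule sph_geometric[OF mu x])
  also have "\<dots> = ?N ^ 2 * (?N - 1) * (\<Sum>j<m. ?q ^ j)" by (simp add: sum_distrib_left)
  also have "real (card (sph x 2)) \<le> ?N ^ 2 * (?N - 1)"
  proof -
    have "real (card (sph x 2)) \<le> real (n ^ 2 * (n - 1))"
      using sph_growth(1)[OF mu x] by (simp only: of_nat_le_iff)
    then show ?thesis using n_ge_2 by (simp add: of_nat_diff)
  qed
  \<comment> \<open>The geometric sum is at most 1/(1 - q), and 1 - q = 4n/(n + 1)^2.\<close>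
  also have "(\<Sum>j<m. ?q ^ j) \<le> (?N + 1) ^ 2 / (4 * ?N)"
  proof -
    have "(1 - ?q) * (\<Sum>j<m. ?q ^ j) = 1 - ?q ^ m" by (rule one_diff_power_eq[symmetric])
    also have "\<dots> \<le> 1" by simp
    also have "1 - ?q = 4 * ?N / (?N + 1) ^ 2"
      using N by (simp add: power_divide field_simps) (simp add: power2_eq_square algebra_simps)
    finally show ?thesis using N by (simp add: field_simps)
  qed
  finally have "real (card V) \<le> 1 + ?N ^ 2 + ?N ^ 2 * (?N - 1) + ?N ^ 2 * (?N - 1) * ((?N + 1) ^ 2 / (4 * ?N))"
    using N by (simp add: mult_left_mono)
  \<comment> \<open>The correction term (4 - n - n^2)/4 is negative because n is at least 2.\<close>
  also have "\<dots> = ?N ^ 3 * (?N + 5) / 4 + (4 - ?N - ?N ^ 2) / 4"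
    using N by (simp add: field_simps) (simp add: eval_nat_numeral algebra_simps)
  also have "\<dots> \<le> ?N ^ 3 * (?N + 5) / 4"
    using N power2_eq_square[of ?N] mult_mono[of 2 ?N 2 ?N] by simp
  finally show ?thesis .
qed

text \<open>A vertex at distance \<open>3 + j\<close> forces the bound of
  \<open>sph_geometric\<close> to be at least 1; logarithms then bound \<open>j\<close>.\<close>

lemma distance_bound:
  assumes mu: "\<And>x y. x \<in> V \<Longrightarrow> y \<in> V \<Longrightarrow> d x y = 2 \<Longrightarrow> n - 1 \<le> card (cn x y)"
    and x: "x \<in> V" and y: "y \<in> V"
  shows "int (d x y) \<le> 2 + \<lceil>ln (real n ^ 2 * (real n - 1)) / (2 * ln ((real n + 1) / (real n - 1)))\<rceil>"
proof -
  let ?N = "real n"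
  let ?L = "ln (?N ^ 2 * (?N - 1)) / (2 * ln ((?N + 1) / (?N - 1)))"
  have N: "2 \<le> ?N" using n_ge_2 by simp
  have ln0: "0 < ln ((?N + 1) / (?N - 1))" using N by simp
  have "1 * 1 \<le> ?N ^ 2 * (?N - 1)" by (rule mult_mono) (use N in auto)
  then have num: "0 \<le> ln (?N ^ 2 * (?N - 1))" by simp
  then have L0: "0 \<le> ?L" using ln0 by simp
  show ?thesis
  proof (cases "d x y \<le> 2")
    case True
    moreover have "0 \<le> \<lceil>?L\<rceil>" using L0 by linarith
    ultimately show ?thesis by linarith
  next
    case False
    then have "3 \<le> d x y" by simp
    then obtain j where j: "d x y = 3 + j" using le_Suc_ex by blast
    then have "sph x (3 + j) \<noteq> {}" using y by (auto simp: sph_def)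
    then have "1 \<le> card (sph x (3 + j))" by (simp add: Suc_le_eq card_gt_0_iff)
    then have "1 \<le> real (card (sph x (3 + j)))" by simp
    then have ge: "1 \<le> ?N ^ 2 * (?N - 1) * (((?N - 1) / (?N + 1)) ^ 2) ^ j"
      using sph_geometric[OF mu x, of j] by (rule order_trans)
    have "((?N + 1) / (?N - 1)) ^ (2 * j) \<le> ?N ^ 2 * (?N - 1)"
      using ge N by (simp add: power_divide field_simps flip: power_mult)
    \<comment> \<open>Equality would make n divide a power of n + 1, to which it is coprime.
      Strictness gives \<open>j < ?L\<close>, so \<open>j + 1\<close> is at most the ceiling; hence
      the constant 2 in the bound, not 3.\<close>
    moreover have "((?N + 1) / (?N - 1)) ^ (2 * j) \<noteq> ?N ^ 2 * (?N - 1)"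
    proof
      assume eq: "((?N + 1) / (?N - 1)) ^ (2 * j) = ?N ^ 2 * (?N - 1)"
      then have "(?N + 1) ^ (2 * j) = ?N ^ 2 * (?N - 1) * (?N - 1) ^ (2 * j)"
        using N by (simp add: power_divide field_simps)
      then have "real ((n + 1) ^ (2 * j)) = real (n ^ 2 * (n - 1) * (n - 1) ^ (2 * j))"
        using n_ge_2 by (simp add: of_nat_diff add.commute)
      then have "(n + 1) ^ (2 * j) = n ^ 2 * (n - 1) * (n - 1) ^ (2 * j)" by (simp only: of_nat_eq_iff)
      then have "n dvd (n + 1) ^ (2 * j)" by (simp add: power2_eq_square)
      moreover have "coprime n ((n + 1) ^ (2 * j))" by simp
      ultimately have "n dvd 1" by (metis coprime_absorb_left)
      then show False using n_ge_2 by simp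
    qed
    ultimately have "((?N + 1) / (?N - 1)) ^ (2 * j) < ?N ^ 2 * (?N - 1)" by simp
    then have "ln (((?N + 1) / (?N - 1)) ^ (2 * j)) < ln (?N ^ 2 * (?N - 1))"
      using N by (subst ln_less_cancel_iff) auto
    then have "real (2 * j) * ln ((?N + 1) / (?N - 1)) < ln (?N ^ 2 * (?N - 1))"
      using N by (simp add: ln_realpow)
    then have "real j < ?L" using ln0 by (simp add: field_simps)
    then have "int j + 1 \<le> \<lceil>?L\<rceil>" by linarith
    then show ?thesis using j by simp
  qed
qed

end

section \<open>Orders at least \<open>2(n - 1)\<close>\<close>

text \<open>\<open>A\<close> and \<open>B\<close> stand for the numbers of vertices at distance 2
  whose mu-graph has order 2(n - 1) and 2n, and \<open>k\<close> for the number at distance 3.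
  Multiplying \<open>v\<close> by n^2 (n - 1) lets \<open>count\<close> be substituted; the
  remaining term with \<open>B\<close> is the slack.\<close>

lemma order_arith:
  fixes n A B k v :: nat
  assumes n: "2 \<le> n" and count: "2 * (n - 1) * A + 2 * n * B = n ^ 2 * (n - 1) ^ 2"
    and k: "n ^ 2 * k \<le> A" and v: "v = 1 + n ^ 2 + A + B + k"
  shows "2 * v \<le> (n ^ 2 + 1) * (n + 1)" "0 < B \<Longrightarrow> 2 * v + 2 \<le> (n ^ 2 + 1) * (n + 1)"
proof -
  obtain m where m: "n = m + 1" "0 < m" using n by (cases n) auto
  let ?T = "(n ^ 2 + 1) * (n + 1)"
  have c: "2 * m * A + 2 * n * B = n ^ 2 * m ^ 2" using count m by simp
  have "2 * m * n ^ 2 * k \<le> 2 * m * A" using k by (simp add: mult.assoc)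
  then have "n ^ 2 * m * (2 * v) + 2 * n * (n + 1) * B \<le>
      2 * n ^ 2 * m + 2 * n ^ 4 * m + n ^ 2 * (2 * m * A) + 2 * n ^ 2 * m * B + 2 * m * A + 2 * n * (n + 1) * B"
    unfolding v by (simp add: algebra_simps power2_eq_square power4_eq_xxxx)
  also have "\<dots> = 2 * n ^ 2 * m + 2 * n ^ 4 * m + (n ^ 2 + 1) * (2 * m * A + 2 * n * B)"
    unfolding m(1) by (simp add: algebra_simps power2_eq_square power4_eq_xxxx)
  also have "\<dots> = n ^ 2 * m * ?T"
    unfolding c unfolding m(1) by (simp add: algebra_simps power2_eq_square power4_eq_xxxx)
  finally have main: "n ^ 2 * m * (2 * v) + 2 * n * (n + 1) * B \<le> n ^ 2 * m * ?T" .
  then have "n ^ 2 * m * (2 * v) \<le> n ^ 2 * m * ?T" by linarith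
  moreover have "0 < n ^ 2 * m" using m by simp
  ultimately show "2 * v \<le> ?T" by (metis mult_le_cancel1)
  show "2 * v + 2 \<le> ?T" if "0 < B"
  proof -
    \<comment> \<open>Modulo \<open>m\<close> the count gives \<open>m <= 2 * B\<close>. This makes
      the slack large enough to keep the bound strict after half of \<open>?T\<close> is rounded
      down.\<close>
    have "m dvd 2 * m * A" "m dvd n ^ 2 * m ^ 2" by (auto simp: power2_eq_square)
    then have "m dvd n * (2 * B)" using c by (metis dvd_add_right_iff mult.assoc mult.left_commute)
    moreover have "coprime m n" unfolding m(1) by simp
    ultimately have "m dvd 2 * B" by (simp add: coprime_dvd_mult_right_iff)
    then have "m \<le> 2 * B" using that by (auto dest: dvd_imp_le)
    then have "n * (n + 1) * m \<le> n * (n + 1) * (2 * B)" by (rule mult_le_mono2)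
    then have "(n * m) * (n * (2 * v) + (n + 1)) \<le> (n * m) * (n * ?T)"
      using main by (simp add: algebra_simps power2_eq_square)
    then have "n * (2 * v) + (n + 1) \<le> n * ?T" using m by simp
    then have "n * (2 * v + 1) < n * ?T" by (simp add: algebra_simps)
    then have "2 * v + 1 < ?T" by simp
    then show ?thesis by simp
  qed
qed

context local_grid
begin

definition mu_big :: bool where
  "mu_big \<longleftrightarrow> (\<forall>x\<in>V. \<forall>y\<in>V. d x y = 2 \<longrightarrow> 2 * (n - 1) \<le> card (cn x y))"

lemma mu_big_cases:
  assumes mu_big "x \<in> V" "y \<in> V" "d x y = 2"
  shows "card (cn x y) = 2 * (n - 1) \<or> card (cn x y) = 2 * n"
proof -
  have "even (card (cn x y))" "card (cn x y) \<le> 2 * n" using mu_bounds[OF assms(2-4)] by auto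
  moreover have "2 * (n - 1) \<le> card (cn x y)" using assms by (simp add: mu_big_def)
  ultimately obtain c where "card (cn x y) = 2 * c" "n - 1 \<le> c" "c \<le> n" by (auto elim!: evenE)
  then show ?thesis by (cases "c = n") auto
qed

text \<open>The mu-graph misses at most one row and one column around \<open>y\<close>, which leaves
  at most one cell; it misses none if its order is 2n.\<close>

lemma card_nxt_2:
  assumes mu_big and x: "x \<in> V" and y: "y \<in> V" and d2: "d x y = 2"
  shows "card (nxt x y) \<le> 1" "card (cn x y) = 2 * n \<Longrightarrow> card (nxt x y) = 0"
proof -
  have dyx: "d y x = 2" using d2 d_sym[OF x y] by simp
  have P: "prv x y = cn y x" using prv_2[OF x d2] cn_commute by simp
  have le: "card (nxt x y) \<le> (n - card (rw y ` cn y x)) * (n - card (cl y ` cn y x))"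
    using card_nxt_le[OF x y] P by simp
  have "2 * (n - 1) \<le> card (cn y x)" using assms(1) y x dyx by (simp add: mu_big_def)
  then have "(n - card (rw y ` cn y x)) * (n - card (cl y ` cn y x)) \<le> 1 * 1"
    by (intro mult_le_mono)
      (use card_cn_eq_rows[OF y x dyx] card_cn_eq_cols[OF y x dyx] in linarith)+
  then show "card (nxt x y) \<le> 1" using le by linarith
  show "card (nxt x y) = 0" if "card (cn x y) = 2 * n"
    using le that card_cn_eq_rows[OF y x dyx] cn_commute[of x y] by simp
qed

lemma nxt_2_unique:
  assumes mu_big "x \<in> V" "y \<in> V" "d x y = 2" "s \<in> nxt x y" "t \<in> nxt x y"
  shows "s = t"
proof -
  have "card (nxt x y) \<le> 1" using card_nxt_2(1)[OF assms(1-4)] .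
  moreover have "finite (nxt x y)" by (simp add: nxt_def)
  ultimately show ?thesis using assms(5,6) by (metis One_nat_def card_le_Suc0_iff_eq)
qed

text \<open>A neighbour of \<open>z\<close> at distance 2 from \<open>x\<close> has no neighbour other than \<open>z\<close> at distance 3 from
  \<open>x\<close>; since the grid around \<open>z\<close> is connected, all neighbours of \<open>z\<close> are at distance 2.\<close>

lemma nb_antipode:
  assumes b: mu_big and x: "x \<in> V" and z: "z \<in> V" and d3: "d x z = 3" and t: "adj z t"
  shows "d x t = 2"
proof -
  have step: "d x t = 2" if y: "adj z y" "d x y = 2" and t: "adj z t" "adj y t" for y t
  proof -
    have "d x t \<le> 3" using d_step[OF t(2) x] y by simp
    moreover have "2 \<le> d x t" using d_step[OF adj_sym[OF t(1)] x] d3 by simp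
    moreover have "d x t \<noteq> 3"
    proof
      assume "d x t = 3"
      then have "t \<in> nxt x y" "z \<in> nxt x y" using y t d3 adj_sym by (auto simp: nxt_def nb_def)
      then have "t = z" using nxt_2_unique[OF b x adj_in_V'[OF y(1)] y(2)] by blast
      then show False using t adj_irrefl by blast
    qed
    ultimately show ?thesis by linarith
  qed
  obtain y where y: "adj z y" "d x y = 2" using d_pred[OF x z, of 2] d3 adj_sym by auto
  obtain p where p: "adj z p" "rw z p = rw z y" "cl z p = cl z t"
    using coords_ex[OF z coords_range(1)[OF y(1)] coords_range(2)[OF t]] .
  have "d x p = 2"
    using step[OF y p(1)] grid_adj[OF y(1) p(1)] coords_inj[OF y(1) p(1)] y(2) p(2) by metis
  then show ?thesis
    using step[OF p(1) _ t] grid_adj[OF p(1) t] coords_inj[OF p(1) t] p(3) by metis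
qed

text \<open>A vertex at distance 4 would be a neighbour of one at distance 3, contrary to
  \<open>nb_antipode\<close>; a vertex still farther away leads back along a geodesic to one at
  distance 4.\<close>

lemma d_le_3:
  assumes b: mu_big and x: "x \<in> V" and y: "y \<in> V"
  shows "d x y \<le> 3"
proof -
  have no4: "d x w \<noteq> 4" if w: "w \<in> V" for w
  proof
    assume "d x w = 4"
    then obtain z where z: "adj z w" "d x z = 3" using d_pred[OF x w, of 3] by auto
    then show False using nb_antipode[OF b x adj_in_V[OF z(1)] z(2,1)] \<open>d x w = 4\<close> by simp
  qed
  have "y \<in> V \<Longrightarrow> d x y = 4 + j \<Longrightarrow> False" for j y
  proof (induction j arbitrary: y)
    case 0
    then show ?case using no4 by simp
  next
    case (Suc j)
    then obtain z where "adj z y" "d x z = 4 + j" using d_pred[OF x Suc.prems(1), of "4 + j"] by auto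
    then show ?case using Suc.IH adj_in_V by blast
  qed
  then have "\<not> 4 \<le> d x y" using y le_Suc_ex by blast
  then show ?thesis by simp
qed

text \<open>Every vertex of the third sphere sends all its n^2 edges to the second, where a vertex
  of \<open>A\<close> receives at most one of them and a vertex of \<open>B\<close> none.\<close>

lemma order_counts:
  assumes b: mu_big and x: "x \<in> V"
  defines "A \<equiv> {y \<in> sph x 2. card (cn x y) = 2 * (n - 1)}"
    and "B \<equiv> {y \<in> sph x 2. card (cn x y) = 2 * n}"
  shows "2 * (n - 1) * card A + 2 * n * card B = n ^ 2 * (n - 1) ^ 2"
    and "n ^ 2 * card (sph x 3) \<le> card A"
    and "card V = 1 + n ^ 2 + card A + card B + card (sph x 3)"
    and "card (sph x 2) = card A + card B"
proof -
  have un: "sph x 2 = A \<union> B" using mu_big_cases[OF b x] by (auto simp: A_def B_def sph_def)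
  have disj: "A \<inter> B = {}" using n_ge_2 by (auto simp: A_def B_def)
  have fin: "finite A" "finite B" by (auto simp: A_def B_def)
  show k2: "card (sph x 2) = card A + card B" using un disj fin by (simp add: card_Un_disjoint)
  have "n ^ 2 * (n - 1) ^ 2 = (\<Sum>y\<in>A. card (cn x y)) + (\<Sum>y\<in>B. card (cn x y))"
    unfolding sum_cn[OF x, symmetric] un by (rule sum.union_disjoint[OF fin disj])
  also have "(\<Sum>y\<in>A. card (cn x y)) = (\<Sum>y\<in>A. 2 * (n - 1))" by (rule sum.cong) (auto simp: A_def)
  also have "(\<Sum>y\<in>B. card (cn x y)) = (\<Sum>y\<in>B. 2 * n)" by (rule sum.cong) (auto simp: B_def)
  finally show "2 * (n - 1) * card A + 2 * n * card B = n ^ 2 * (n - 1) ^ 2"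
    by (simp add: mult.commute)
  have V: "z \<in> sph x i \<Longrightarrow> z \<in> V \<and> d x z = i" for z i by (simp add: sph_def)
  have "n ^ 2 * card (sph x 3) = (\<Sum>z\<in>sph x (Suc 2). card (prv x z))"
  proof -
    have "(\<Sum>z\<in>sph x (Suc 2). card (prv x z)) = (\<Sum>z\<in>sph x (Suc 2). n ^ 2)"
    proof (rule sum.cong)
      fix z assume "z \<in> sph x (Suc 2)"
      then have z: "z \<in> V" "d x z = 3" by (auto simp: sph_def)
      then have "prv x z = nb z" using nb_antipode[OF b x z] by (auto simp: prv_def nb_def)
      then show "card (prv x z) = n ^ 2" using card_nb[OF z(1)] by simp
    qed simp
    then show ?thesis by (simp add: eval_nat_numeral)
  qed
  also have "\<dots> = (\<Sum>y\<in>sph x 2. card (nxt x y))" by (rule sum_nxt_prv[symmetric])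
  also have "\<dots> = (\<Sum>y\<in>A. card (nxt x y)) + (\<Sum>y\<in>B. card (nxt x y))"
    unfolding un by (rule sum.union_disjoint[OF fin disj])
  also have "(\<Sum>y\<in>B. card (nxt x y)) = (\<Sum>y\<in>B. 0)"
    by (rule sum.cong) (use card_nxt_2(2)[OF b x] V in \<open>auto simp: B_def\<close>)
  also have "(\<Sum>y\<in>A. card (nxt x y)) \<le> (\<Sum>y\<in>A. 1)"
    by (rule sum_mono) (use card_nxt_2(1)[OF b x] V in \<open>auto simp: A_def\<close>)
  finally show "n ^ 2 * card (sph x 3) \<le> card A" by simp
  have "card V = (\<Sum>i<4. card (sph x i))"
    by (rule card_V_sph) (use d_le_3[OF b x] in fastforce)
  also have "\<dots> = card (sph x 0) + card (sph x 1) + card (sph x 2) + card (sph x 3)"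
    by (simp add: eval_nat_numeral)
  finally show "card V = 1 + n ^ 2 + card A + card B + card (sph x 3)"
    using k2 by (simp only: sph_0[OF x] sph_1[OF x] card_nb[OF x]) simp
qed

lemma order_bound_mu_big: "mu_big \<Longrightarrow> 2 * card V \<le> (n ^ 2 + 1) * (n + 1)"
proof -
  assume b: mu_big
  obtain x where "x \<in> V" using V_nonempty by blast
  then show ?thesis using order_arith(1)[OF n_ge_2 order_counts(1-3)[OF b]] by blast
qed

lemma order_bound_strict:
  assumes b: mu_big and x: "x \<in> V" "y \<in> V" "d x y = 2" "card (cn x y) \<noteq> 2 * (n - 1)"
  shows "2 * card V + 2 \<le> (n ^ 2 + 1) * (n + 1)"
proof (rule order_arith(2)[OF n_ge_2 order_counts(1-3)[OF b x(1)]])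
  have "y \<in> {y \<in> sph x 2. card (cn x y) = 2 * n}"
    using mu_big_cases[OF b x(1-3)] x by (auto simp: sph_def)
  then show "0 < card {y \<in> sph x 2. card (cn x y) = 2 * n}" by (auto simp: card_gt_0_iff)
qed

end

section \<open>Closed walks modulo a prime\<close>

text \<open>\<open>f\<close> generates an action of the cyclic group of order \<open>p\<close>. As
  \<open>p\<close> is prime and \<open>f\<close> has no fixed point, every orbit has exactly
  \<open>p\<close> elements.\<close>

lemma prime_dvd_card_free_action:
  assumes p: "prime (p::nat)" and fin: "finite A" and f: "\<And>x. x \<in> A \<Longrightarrow> f x \<in> A"
    and per: "\<And>x. x \<in> A \<Longrightarrow> (f ^^ p) x = x" and free: "\<And>x. x \<in> A \<Longrightarrow> f x \<noteq> x"
  shows "p dvd card A"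
proof -
  have fA: "(f ^^ k) x \<in> A" if "x \<in> A" for k x using that by (induction k) (auto intro: f)
  have per': "(f ^^ (p * k)) x = x" if "x \<in> A" for k x
    using that by (induction k) (auto simp: funpow_add per)
  \<comment> \<open>If \<open>f ^^ i\<close> fixed \<open>x\<close>, then a multiple of
    \<open>i\<close> congruent to 1 modulo \<open>p\<close> would show that \<open>f\<close> fixes
    \<open>x\<close>.\<close>
  have cop: "(f ^^ i) x \<noteq> x" if "x \<in> A" "0 < i" "i < p" for i x
  proof
    assume eq: "(f ^^ i) x = x"
    have "(f ^^ (i * k)) x = x" for k using eq by (induction k) (auto simp: funpow_add)
    moreover have "coprime i p"
      using p that by (metis coprime_commute nat_dvd_not_less prime_imp_coprime)
    then obtain a where "[i * a = 1] (mod p)" using cong_solve_coprime_nat by auto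
    moreover have "(f ^^ (1 + p * b)) x = f x" for b using per'[OF that(1)] by simp
    moreover have "1 < p" using p prime_gt_1_nat by blast
    ultimately show False
      using free[OF that(1)] unfolding cong_def by (metis add.commute mod_less mult_div_mod_eq)
  qed
  define r where "r = {(x, y). x \<in> A \<and> y \<in> A \<and> (\<exists>k. y = (f ^^ k) x)}"
  have eqv: "equiv A r"
  proof (rule equivI)
    show "r \<subseteq> A \<times> A" by (auto simp: r_def)
    show "refl_on A r" by (auto simp: refl_on_def r_def intro: exI[of _ 0])
    show "sym r"
    proof (rule symI)
      fix x y assume "(x, y) \<in> r"
      then obtain k where k: "x \<in> A" "y = (f ^^ k) x" by (auto simp: r_def)
      \<comment> \<open>\<open>f ^^ (p * k - k)\<close> inverts \<open>f ^^ k\<close> on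
        \<open>A\<close>.\<close>
      have "k \<le> p * k" using p prime_gt_0_nat[OF p] by simp
      then have "(f ^^ (p * k - k)) y = (f ^^ (p * k)) x"
        using k by (metis comp_apply funpow_add le_add_diff_inverse2)
      then have "x = (f ^^ (p * k - k)) y" using per'[OF k(1)] by simp
      then show "(y, x) \<in> r" using k fA by (auto simp: r_def)
    qed
    show "trans r"
    proof (rule transI)
      fix x y z assume "(x, y) \<in> r" "(y, z) \<in> r"
      then obtain k l where "x \<in> A" "z \<in> A" "y = (f ^^ k) x" "z = (f ^^ l) y" by (auto simp: r_def)
      then have "x \<in> A" "z \<in> A" "z = (f ^^ (l + k)) x" by (auto simp: funpow_add)
      then show "(x, z) \<in> r" unfolding r_def by blast
    qed
  qed
  have "p dvd card X" if "X \<in> A // r" for X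
  proof -
    obtain x where x: "x \<in> A" "X = r `` {x}" using \<open>X \<in> A // r\<close> by (auto elim: quotientE)
    have "X = (\<lambda>k. (f ^^ k) x) ` {..<p}"
    proof (intro equalityI subsetI)
      fix y assume "y \<in> X"
      then obtain k where "y = (f ^^ k) x" using x by (auto simp: r_def)
      moreover have "(f ^^ (k mod p + p * (k div p))) x = (f ^^ (k mod p)) x"
        unfolding funpow_add comp_apply per'[OF x(1)] ..
      ultimately have "y = (f ^^ (k mod p)) x" by simp
      then show "y \<in> (\<lambda>k. (f ^^ k) x) ` {..<p}" using prime_gt_0_nat[OF p] by auto
    qed (use x fA in \<open>auto simp: r_def\<close>)
    moreover have "inj_on (\<lambda>k. (f ^^ k) x) {..<p}"
    proof (rule linorder_inj_onI)
      fix i j assume ij: "i < j" "i \<in> {..<p}" "j \<in> {..<p}"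
      have "(f ^^ j) x = (f ^^ (j - i)) ((f ^^ i) x)"
        using ij(1) by (metis comp_apply funpow_add le_add_diff_inverse2 less_imp_le)
      then show "(f ^^ i) x \<noteq> (f ^^ j) x"
        using cop[OF fA[OF x(1), of i], of "j - i"] ij by force
    qed auto
    ultimately show ?thesis by (simp add: card_image)
  qed
  then show ?thesis by (rule equiv_imp_dvd_card[OF fin eqv])
qed

text \<open>Equivalently, a symmetric design with a polarity without absolute points.\<close>

locale polarity_graph =
  fixes X :: "'a set" and R :: "'a \<Rightarrow> 'a \<Rightarrow> bool" and k c :: nat
  assumes finite_X: "finite X" and X_nonempty: "X \<noteq> {}"
    and R_sym: "R x y \<Longrightarrow> R y x" and R_irrefl: "\<not> R x x"
    and R_degree: "x \<in> X \<Longrightarrow> card {y \<in> X. R x y} = k"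
    and R_common: "x \<in> X \<Longrightarrow> y \<in> X \<Longrightarrow> x \<noteq> y \<Longrightarrow> card {z \<in> X. R x z \<and> R z y} = c"
begin

text \<open>The identity k(k - 1) = lambda(v - 1) of symmetric designs: walks of length 2 from a
  fixed vertex to the other vertices, counted by end and by midpoint.\<close>

lemma count: "k * (k - 1) = c * (card X - 1)"
proof -
  obtain x where x: "x \<in> X" using X_nonempty by blast
  have "(\<Sum>y\<in>X - {x}. card {z \<in> X. R x z \<and> R z y}) = (\<Sum>y\<in>X - {x}. c)"
    by (rule sum.cong) (auto simp: R_common x)
  moreover have "(\<Sum>y\<in>X - {x}. card {z \<in> X. R x z \<and> R z y})
      = (\<Sum>y\<in>X - {x}. card {z \<in> {z \<in> X. R x z}. R z y})"
    by (rule sum.cong) (auto intro: arg_cong[of _ _ card])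
  moreover have "\<dots> = (\<Sum>z\<in>{z \<in> X. R x z}. card {y \<in> X - {x}. R z y})"
    by (rule sum_multicount_gen) (simp_all add: finite_X)
  moreover have "\<dots> = (\<Sum>z\<in>{z \<in> X. R x z}. k - 1)"
  proof (rule sum.cong)
    fix z assume z: "z \<in> {z \<in> X. R x z}"
    have "{y \<in> X - {x}. R z y} = {y \<in> X. R z y} - {x}" by auto
    then show "card {y \<in> X - {x}. R z y} = k - 1"
      using z x R_degree[of z] R_sym by (simp add: card_Diff_singleton)
  qed simp
  ultimately have "(\<Sum>y\<in>X - {x}. c) = (\<Sum>z\<in>{z \<in> X. R x z}. k - 1)" by (simp only:)
  then show ?thesis using R_degree[OF x] x by (simp add: card_Diff_singleton mult.commute)
qed

text \<open>The lists hold the interior vertices only, so \<open>walks x y m\<close> describes the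
  walks of length \<open>m + 1\<close>.\<close>

definition walks :: "'a \<Rightarrow> 'a \<Rightarrow> nat \<Rightarrow> 'a list set" where
  "walks x y m = {xs. length xs = m \<and> set xs \<subseteq> X \<and> successively R (x # xs @ [y])}"

lemma finite_walks: "finite (walks x y m)"
  by (rule finite_subset[OF _ finite_lists_length_eq[OF finite_X, of m]]) (auto simp: walks_def)

lemma walks_Suc: "walks x y (Suc m) = (\<Union>z\<in>{z \<in> X. R x z}. (#) z ` walks z y m)"
  by (auto simp: walks_def length_Suc_conv)

lemma card_walks_Suc: "card (walks x y (Suc m)) = (\<Sum>z\<in>{z \<in> X. R x z}. card (walks z y m))"
proof -
  have "card (walks x y (Suc m)) = (\<Sum>z\<in>{z \<in> X. R x z}. card ((#) z ` walks z y m))"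
    unfolding walks_Suc by (rule card_UN_disjoint) (use finite_X in \<open>auto simp: finite_walks\<close>)
  then show ?thesis by (simp add: card_image)
qed

text \<open>There are \<open>k\<close> walks of length 2 from a vertex to itself and
  \<open>c\<close> to any other vertex, so modulo \<open>q\<close> the end does not matter; each
  further step multiplies the number by \<open>k\<close>.\<close>

lemma walks_cong:
  assumes c: "[c = k] (mod q)" and "x \<in> X" "y \<in> X"
  shows "[card (walks x y (Suc m)) = k ^ Suc m] (mod q)"
  using assms(2)
proof (induction m arbitrary: x)
  case 0
  have "walks x y 1 = (\<lambda>z. [z]) ` {z \<in> X. R x z \<and> R z y}"
    by (auto simp: walks_def length_Suc_conv)
  then have "card (walks x y 1) = card {z \<in> X. R x z \<and> R z y}" by (simp add: card_image inj_on_def)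
  moreover have "{z \<in> X. R x z \<and> R z x} = {z \<in> X. R x z}" using R_sym by auto
  ultimately have "card (walks x y 1) = (if x = y then k else c)"
    using R_degree[OF 0] R_common[OF 0 assms(3)] by auto
  then show ?case using c by simp
next
  case (Suc m)
  have "[(\<Sum>z\<in>{z \<in> X. R x z}. card (walks z y (Suc m))) = (\<Sum>z\<in>{z \<in> X. R x z}. k ^ Suc m)] (mod q)"
    by (rule cong_sum) (use Suc.IH in auto)
  then show ?case unfolding card_walks_Suc[of x y "Suc m"] using R_degree[OF Suc.prems] by simp
qed

text \<open>The cyclic group of order \<open>p\<close> acts freely on the closed walks of length \<open>p\<close>, whose number
  is congruent to \<open>card X * k ^ (p - 1)\<close>.\<close>

lemma prime_dvd_degree:
  assumes p: "prime p" and c: "[c = k] (mod p)"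
  shows "p dvd k"
proof -
  obtain q where q: "p = Suc (Suc q)"
    using prime_ge_2_nat[OF p] by (metis add_2_eq_Suc le_Suc_ex)
  \<comment> \<open>A closed walk is stored without repeating its first vertex;
    \<open>Suc q = p - 1\<close> vertices follow the first one.\<close>
  define C where "C = {xs. length xs = p \<and> set xs \<subseteq> X \<and> successively R (xs @ [hd xs])}"
  have Cwalks: "C = (\<Union>x\<in>X. (#) x ` walks x x (Suc q))"
    by (auto simp: C_def walks_def q length_Suc_conv[of _ "Suc q"])
  then have "card C = (\<Sum>x\<in>X. card ((#) x ` walks x x (Suc q)))"
    by (simp only:) (rule card_UN_disjoint, use finite_X in \<open>auto simp: finite_walks\<close>)
  then have cardC: "card C = (\<Sum>x\<in>X. card (walks x x (Suc q)))" by (simp add: card_image)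
  have "[card C = (\<Sum>x\<in>X. k ^ Suc q)] (mod p)"
    unfolding cardC by (rule cong_sum) (rule walks_cong[OF c])
  moreover have "p dvd card C"
  proof (rule prime_dvd_card_free_action[OF p, of C rotate1])
    show "finite C"
      by (rule finite_subset[OF _ finite_lists_length_eq[OF finite_X, of p]]) (auto simp: C_def)
    fix xs assume xs: "xs \<in> C"
    then obtain x y ys where xs_eq: "xs = x # y # ys" and len: "length ys = q"
      by (auto simp: C_def q length_Suc_conv)
    have suc: "R x y" "successively R (y # ys @ [x])" using xs by (auto simp: C_def xs_eq)
    have "successively R (y # ys @ [x]) \<and> R (last (y # ys @ [x])) (hd [y])"
      using suc by simp
    then have "successively R ((y # ys @ [x]) @ [y])"
      by (subst successively_append_iff) simp
    then show "rotate1 xs \<in> C" using xs by (auto simp: C_def xs_eq)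
    show "(rotate1 ^^ p) xs = xs"
      using xs rotate_id[of p xs] by (simp add: C_def rotate_def)
    have "x \<noteq> y" using suc(1) R_irrefl by blast
    then show "rotate1 xs \<noteq> xs" by (auto simp: xs_eq)
  qed
  ultimately have dvd: "p dvd card X * k ^ Suc q" by (simp add: cong_dvd_iff)
  have "card X > 0" using finite_X X_nonempty by (simp add: card_gt_0_iff)
  \<comment> \<open>\<open>count\<close> and the congruence show that \<open>k * card X\<close> is
    congruent to \<open>k * k\<close>, which eliminates \<open>card X\<close> from
    \<open>dvd\<close>.\<close>
  then have "c * card X = k * (k - 1) + c" using count by (cases "card X") auto
  moreover have "[c * card X = k * card X] (mod p)" using c by (rule cong_scalar_right)
  moreover have "[k * (k - 1) + c = k * (k - 1) + k] (mod p)" using c by (simp add: cong_add_lcancel_nat)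
  moreover have "k * (k - 1) + k = k * k" by (cases k) auto
  ultimately have "[k * card X = k * k] (mod p)" by (metis cong_sym cong_trans)
  then have "[k * card X * k ^ Suc q = k * k * k ^ Suc q] (mod p)" by (rule cong_scalar_right)
  moreover have "p dvd k * card X * k ^ Suc q" using dvd by (simp add: mult.assoc)
  ultimately have "p dvd k * k * k ^ Suc q" using cong_dvd_iff by blast
  then have "p dvd k ^ (q + 3)" by (simp add: power_add eval_nat_numeral mult_ac)
  then show ?thesis using p prime_dvd_power by blast
qed

end

section \<open>Arithmetic that determines the size of the antipodal classes\<close>

lemma fibre_size_unique:
  fixes n r :: nat
  assumes odd: "odd n" and n: "2 \<le> n" and dvd: "2 * r dvd n * (n + 1)" and r: "2 * r \<le> n + 1"
    and primes: "\<And>p. prime p \<Longrightarrow> p dvd n ^ 2 - 2 * (n - 1) * r \<Longrightarrow> p dvd n"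
  shows "2 * r = n + 1"
proof -
  \<comment> \<open>Splitting 2r = uv with u dividing n and v dividing n + 1 exhibits n^2 - 2(n -
    1)r as \<open>u * W\<close>, where \<open>W\<close> is defined below.\<close>
  obtain u v where uv: "2 * r = u * v" "u dvd n" "v dvd n + 1"
    using division_decomp[OF dvd] by blast
  then obtain a where a: "n = u * a" by blast
  have u0: "0 < u" and a0: "0 < a" using a n by (auto intro: Nat.gr0I)
  have "2 * r * (n - 1) \<le> (n + 1) * (n - 1)" using r by (rule mult_le_mono1)
  also have "\<dots> < n * n" using n by (cases n) (auto simp: algebra_simps)
  also have "n * n = u * (a * n)" using a by (metis mult.assoc)
  finally have "u * ((n - 1) * v) < u * (a * n)" unfolding uv(1) by (simp only: mult_ac)
  then have lt: "(n - 1) * v < a * n" using u0 by simp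
  define W where "W = a * n - (n - 1) * v"
  have W: "a * n = (n - 1) * v + W" using lt by (simp add: W_def)
  have "n ^ 2 - 2 * (n - 1) * r = u * (a * n) - u * ((n - 1) * v)"
  proof -
    have "n ^ 2 = u * (a * n)" using a by (metis mult.assoc power2_eq_square)
    moreover have "2 * (n - 1) * r = u * ((n - 1) * v)" using uv(1) by (simp add: mult_ac)
    ultimately show ?thesis by (simp only:)
  qed
  then have sigma: "n ^ 2 - 2 * (n - 1) * r = u * W" by (simp add: W_def diff_mult_distrib2)
  \<comment> \<open>A prime factor of \<open>W\<close> would divide n by \<open>primes\<close>, then
    (n - 1)v, then v because it cannot divide n - 1, and finally n + 1, which is impossible.\<close>
  have "W = 1"
  proof (rule ccontr)
    assume "W \<noteq> 1"
    then obtain p where p: "prime p" "p dvd W" using prime_factor_nat by blast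
    then have pn: "p dvd n" using primes[of p] sigma by simp
    then have "p dvd (n - 1) * v" using W p(2) by (metis dvd_add_left_iff dvd_mult)
    moreover have "\<not> p dvd n - 1"
    proof
      assume "p dvd n - 1"
      then have "p dvd n - (n - 1)" using pn dvd_diff_nat by blast
      then show False using n p(1) by simp
    qed
    ultimately have "p dvd n + 1" using p(1) uv(3) by (meson dvd_trans prime_dvd_multD)
    then show False using pn p(1) by (metis dvd_add_right_iff not_prime_unit)
  qed
  then have eq: "a * n = (n - 1) * v + 1" using W by simp
  obtain m where m: "n = Suc m" "0 < m" using n by (cases n) auto
  obtain a' where a': "a = Suc a'" using a0 by (cases a) auto
  have eq': "a' + a * m = m * v" using eq m a' by (simp add: algebra_simps)
  \<comment> \<open>With m = n - 1 and a' = a - 1, either a = 1 and 2r = n, impossible for odd n, or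
    a = n and 2r = n + 1.\<close>
  then have "m dvd a'" by (metis dvd_add_left_iff dvd_triv_left dvd_triv_right)
  moreover have "a' \<le> m" using a a' m u0 by (metis Suc_le_mono dvd_imp_le dvd_triv_right zero_less_Suc)
  ultimately consider "a' = 0" | "a' = m" using dvd_imp_le by fastforce
  then show ?thesis
  proof cases
    case 1
    then have "v = 1" "u = n" using eq' a' m a by auto
    then show ?thesis using uv(1) odd by presburger
  next
    case 2
    then have "u * n = n" using a' m a by simp
    then have "u = 1" using n by simp
    moreover have "m * v = m * (n + 1)" using eq' 2 a' m by (simp add: algebra_simps)
    then have "v = n + 1" using m(2) nat_mult_eq_cancel1 by blast
    ultimately show ?thesis using uv(1) by simp
  qed
qed

section \<open>All orders equal to \<open>2(n - 1)\<close>\<close>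

text \<open>Sending each element to its partner is an involution without fixed points: the case p =
  2 of \<open>prime_dvd_card_free_action\<close>.\<close>

lemma even_card_perfect_matching:
  assumes fin: "finite C" and sym: "\<And>x y. R x y \<Longrightarrow> R y x" and irrefl: "\<And>x. \<not> R x x"
    and ex1: "\<And>x. x \<in> C \<Longrightarrow> \<exists>!y. y \<in> C \<and> R x y"
  shows "even (card C)"
proof -
  define f where "f x = (THE y. y \<in> C \<and> R x y)" for x
  have f: "f x \<in> C \<and> R x (f x)" if "x \<in> C" for x
    unfolding f_def by (rule theI') (rule ex1[OF that])
  have "2 dvd card C"
  proof (rule prime_dvd_card_free_action[OF two_is_prime_nat fin])
    fix x assume x: "x \<in> C"
    show "f x \<in> C" using f x by blast
    show "f x \<noteq> x" using f[OF x] irrefl by metis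
    have "f (f x) = x" using ex1[of "f x"] f[of "f x"] f[OF x] sym x by blast
    then show "(f ^^ 2) x = x" by (simp add: numeral_2_eq_2)
  qed
  then show ?thesis .
qed

section \<open>Cliques of order \<open>n + 1\<close>\<close>

context local_grid
begin

definition clq :: "'a set \<Rightarrow> bool" where
  "clq C \<longleftrightarrow> C \<subseteq> V \<and> card C = n + 1 \<and> (\<forall>p\<in>C. \<forall>q\<in>C. p \<noteq> q \<longrightarrow> adj p q)"

lemma clq_row:
  assumes y: "y \<in> V" and a: "a \<in> {1..n}"
  shows "clq (insert y {t \<in> nb y. rw y t = a})"
  unfolding clq_def
proof (intro conjI ballI impI)
  show "insert y {t \<in> nb y. rw y t = a} \<subseteq> V" using y nb_subset by blast
  have "y \<notin> {t \<in> nb y. rw y t = a}" using adj_irrefl by (simp add: nb_def)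
  then show "card (insert y {t \<in> nb y. rw y t = a}) = n + 1"
    using card_row[OF y a] by (subst card_insert_disjoint) auto
  fix p q assume pq: "p \<in> insert y {t \<in> nb y. rw y t = a}" "q \<in> insert y {t \<in> nb y. rw y t = a}" "p \<noteq> q"
  show "adj p q"
  proof (cases "p = y \<or> q = y")
    case True
    then show ?thesis using pq adj_sym by (auto simp: nb_def)
  next
    case False
    then have "adj y p" "adj y q" "rw y p = rw y q" using pq by (auto simp: nb_def)
    then show ?thesis using grid_adj coords_inj pq(3) by blast
  qed
qed

lemma finite_clq: "clq C \<Longrightarrow> finite C"
  unfolding clq_def using finite_subset finite_V by blast

text \<open>The other n members form a clique in the grid around \<open>w\<close>, so they lie in
  one row or column, and by cardinality they fill it.\<close>

lemma clq_line_cases: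
  assumes C: "clq C" and w: "w \<in> C"
  obtains a where "a \<in> {1..n}" "C = insert w {t \<in> nb w. rw w t = a}"
  | a where "a \<in> {1..n}" "C = insert w {t \<in> nb w. cl w t = a}"
proof -
  have wV: "w \<in> V" and adj: "\<And>p q. p \<in> C \<Longrightarrow> q \<in> C \<Longrightarrow> p \<noteq> q \<Longrightarrow> adj p q"
    and cardC: "card (C - {w}) = n"
    using C w finite_clq[OF C] by (auto simp: clq_def)
  have sub: "C - {w} \<subseteq> nb w" using adj w by (auto simp: nb_def)
  have "C - {w} \<noteq> {}" using cardC n_ge_2 by (metis card.empty not_numeral_le_zero)
  then obtain y where y: "y \<in> C - {w}" by blast
  then have wy: "adj w y" using sub by (auto simp: nb_def)
  have "(\<forall>p\<in>C - {w}. rw w p = rw w y) \<or> (\<forall>p\<in>C - {w}. cl w p = cl w y)"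
    by (rule clique_line[OF sub _ y]) (use adj in auto)
  then show thesis
  proof
    assume "\<forall>p\<in>C - {w}. rw w p = rw w y"
    then have "C - {w} \<subseteq> {t \<in> nb w. rw w t = rw w y}" using sub by blast
    then have "C - {w} = {t \<in> nb w. rw w t = rw w y}"
      using cardC card_row[OF wV coords_range(1)[OF wy]] by (intro card_subset_eq) auto
    then have "C = insert w {t \<in> nb w. rw w t = rw w y}" using w by blast
    then show thesis using that(1) coords_range(1)[OF wy] by blast
  next
    assume "\<forall>p\<in>C - {w}. cl w p = cl w y"
    then have "C - {w} \<subseteq> {t \<in> nb w. cl w t = cl w y}" using sub by blast
    moreover have "card {t \<in> nb w. cl w t = cl w y} = n"
      using local_grid.card_row[OF swap wV coords_range(2)[OF wy]] .
    ultimately have "C - {w} = {t \<in> nb w. cl w t = cl w y}"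
      using cardC by (intro card_subset_eq) auto
    then have "C = insert w {t \<in> nb w. cl w t = cl w y}" using w by blast
    then show thesis using that(2) coords_range(2)[OF wy] by blast
  qed
qed

text \<open>Besides \<open>w\<close> itself, only the cell of row \<open>a\<close> in the column of
  \<open>s\<close> is adjacent to \<open>s\<close>.\<close>

lemma row_meet:
  assumes s: "adj w s" "rw w s \<noteq> a" and a: "a \<in> {1..n}"
  shows "card {t \<in> insert w {t \<in> nb w. rw w t = a}. adj s t} = 2"
proof -
  have wV: "w \<in> V" using s adj_in_V by blast
  obtain t where t: "adj w t" "rw w t = a" "cl w t = cl w s"
    using coords_ex[OF wV a coords_range(2)[OF s(1)]] .
  have "{t \<in> insert w {t \<in> nb w. rw w t = a}. adj s t} = {w, t}"
  proof (intro equalityI subsetI)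
    fix u assume u: "u \<in> {t \<in> insert w {t \<in> nb w. rw w t = a}. adj s t}"
    show "u \<in> {w, t}"
    proof (cases "u = w")
      case False
      then have u: "adj w u" "rw w u = a" "adj s u" using u by (auto simp: nb_def)
      then have "cl w u = cl w s" using grid_adj[OF s(1) u(1)] s(2) by auto
      then show ?thesis using coords_inj[OF u(1) t(1)] u t by auto
    qed simp
  next
    fix u assume u: "u \<in> {w, t}"
    have "adj s t" using grid_adj[OF s(1) t(1)] s t by auto
    then show "u \<in> {t \<in> insert w {t \<in> nb w. rw w t = a}. adj s t}"
      using u t adj_sym[OF s(1)] by (auto simp: nb_def)
  qed
  moreover have "w \<noteq> t" using t adj_irrefl by blast
  ultimately show ?thesis by simp
qed

lemma clq_two:
  assumes C: "clq C" and s: "s \<notin> C" and w: "w \<in> C" and adj: "adj s w"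
  shows "card {w \<in> C. adj s w} = 2"
  using C w
proof (cases rule: clq_line_cases)
  case (1 a)
  have "rw w s \<noteq> a" using 1 s adj adj_sym by (auto simp: nb_def)
  then show ?thesis using row_meet[OF adj_sym[OF adj] _ 1(1)] 1(2) by simp
next
  case (2 a)
  have "cl w s \<noteq> a" using 2 s adj adj_sym by (auto simp: nb_def)
  then show ?thesis using local_grid.row_meet[OF swap adj_sym[OF adj] _ 2(1)] 2(2)
    by simp
qed

end

locale tight_local_grid = local_grid +
  assumes mu_eq: "x \<in> V \<Longrightarrow> y \<in> V \<Longrightarrow> d x y = 2 \<Longrightarrow> card (cn x y) = 2 * (n - 1)"
begin

lemma swap_tight: "tight_local_grid V adj n d cl rw"
proof -
  interpret s: local_grid V adj n d cl rw by (rule swap)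
  show ?thesis by unfold_locales (rule mu_eq)
qed

lemma big: mu_big
  using mu_eq by (simp add: mu_big_def)

lemmas d3 = d_le_3[OF big]

text \<open>Adjacent vertices and vertices at distance 2 share the same value here; this makes the
  number of common neighbours in the quotient graph constant.\<close>

lemma card_cn_near:
  assumes "x \<in> V" "y \<in> V" "x \<noteq> y" "d x y \<noteq> 3"
  shows "card (cn x y) = 2 * (n - 1)"
proof -
  consider "d x y = 1" | "d x y = 2"
    using d3[OF assms(1,2)] assms(4) d_eq_0[OF assms(1,2)] assms(3) by linarith
  then show ?thesis using card_cn_adj[of x y] d_1_adj[OF assms(1,2)] mu_eq[OF assms(1,2)] by cases auto
qed

lemma cn_far:
  assumes "x \<in> V" "d x y = 3" shows "cn x y = {}"
proof (rule ccontr)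
  assume "cn x y \<noteq> {}"
  then obtain s where "adj x s" "adj s y" using adj_sym by (auto simp: cn_def nb_def)
  then show False using d_step[of s y x] d_adj[of x s] assms by simp
qed

lemma card_sph_2: "x \<in> V \<Longrightarrow> 2 * card (sph x 2) = n ^ 2 * (n - 1)"
proof -
  assume x: "x \<in> V"
  have "{y \<in> sph x 2. card (cn x y) = 2 * n} = {}"
    using mu_eq[OF x] n_ge_2 by (auto simp: sph_def)
  then have e: "card {y \<in> sph x 2. card (cn x y) = 2 * n} = 0" by (simp only: card.empty)
  have "2 * (n - 1) * card (sph x 2) = n ^ 2 * (n - 1) ^ 2"
    using order_counts(1,4)[OF big x] e by simp
  then have "(n - 1) * (2 * card (sph x 2)) = (n - 1) * (n ^ 2 * (n - 1))"
    by (simp add: power2_eq_square mult_ac)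
  then show ?thesis using n_ge_2 by simp
qed

section \<open>Antipodal classes\<close>

definition same :: "'a \<Rightarrow> 'a \<Rightarrow> bool" where
  "same x y \<longleftrightarrow> x \<in> V \<and> y \<in> V \<and> (x = y \<or> d x y = 3)"

definition block :: "'a \<Rightarrow> 'a set" where "block x = {y. same x y}"

definition blocks :: "'a set set" where "blocks = block ` V"

text \<open>The order minus the degree and the size of a second sphere leaves one more than the size
  of a third sphere. In this form no base vertex has to be chosen.\<close>

definition r :: nat where "r = card V - n ^ 2 - n ^ 2 * (n - 1) div 2"

lemma card_V_r: "2 * card V = 2 * r + n ^ 2 * (n + 1)"
  and card_block: "x \<in> V \<Longrightarrow> card (block x) = r"
  and r_le: "2 * r \<le> n + 1"
proof -
  have *: "2 * card V = 2 * r + n ^ 2 * (n + 1) \<and> card (block x) = r \<and> 2 * r \<le> n + 1"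
    if x: "x \<in> V" for x
  proof -
    have k2: "card (sph x 2) = n ^ 2 * (n - 1) div 2" using card_sph_2[OF x] by simp
    have V: "card V = 1 + n ^ 2 + card (sph x 2) + card (sph x 3)"
      using order_counts(3,4)[OF big x] by simp
    have r: "r = 1 + card (sph x 3)" unfolding r_def k2[symmetric] V by simp
    have "block x = insert x (sph x 3)" using x by (auto simp: block_def same_def sph_def)
    moreover have "x \<notin> sph x 3" using d_eq_0[OF x x] by (auto simp: sph_def)
    ultimately have "card (block x) = r" using r by simp
    moreover have "2 * card V = 2 * r + n ^ 2 * (n + 1)"
      using V r card_sph_2[OF x] n_ge_2 by (cases n) (simp_all add: algebra_simps)
    moreover have "n ^ 2 * card (sph x 3) \<le> card (sph x 2)"
      using order_counts(2,4)[OF big x] by linarith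
    then have "n ^ 2 * (2 * card (sph x 3)) \<le> n ^ 2 * (n - 1)" using card_sph_2[OF x] by linarith
    then have "2 * card (sph x 3) \<le> n - 1" using n_ge_2 by simp
    ultimately show ?thesis using r n_ge_2 by linarith
  qed
  then show "x \<in> V \<Longrightarrow> card (block x) = r" by blast
  show "2 * card V = 2 * r + n ^ 2 * (n + 1)" "2 * r \<le> n + 1" using * V_nonempty by blast+
qed

lemma same_sym: "same x y \<Longrightarrow> same y x"
  using d_sym by (auto simp: same_def)

text \<open>Let \<open>x\<close> and \<open>z\<close> both be at distance 3 from \<open>y\<close>.
  They are not adjacent, since neighbours of \<open>x\<close> are at distance 2 from
  \<open>y\<close>; and a common neighbour would have two neighbours at distance 3 from
  \<open>y\<close>, against \<open>nxt_2_unique\<close>.\<close>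

lemma same_trans: assumes "same x y" "same y z" shows "same x z"
proof (cases "x = y \<or> y = z \<or> x = z")
  case False
  then have V: "x \<in> V" "y \<in> V" "z \<in> V" and d: "d y x = 3" "d y z = 3"
    using assms same_sym[OF assms(1)] by (auto simp: same_def)
  have "d x z \<noteq> 0" using d_eq_0 V False by simp
  moreover have "d x z \<noteq> 1"
    using nb_antipode[OF big V(2,1) d(1), of z] d_1_adj V d(2) by auto
  moreover have "d x z \<noteq> 2"
  proof
    assume "d x z = 2"
    then obtain w where w: "adj x w" "adj w x" "adj w z"
      using cn_nonempty[OF V(1,3)] adj_sym by (auto simp: cn_def nb_def)
    have "d y w = 2" using nb_antipode[OF big V(2,1) d(1) w(1)] .
    then have "x \<in> nxt y w" "z \<in> nxt y w" using w d by (auto simp: nxt_def nb_def)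
    then show False
      using nxt_2_unique[OF big V(2) adj_in_V'[OF w(1)] \<open>d y w = 2\<close>] False by blast
  qed
  ultimately have "d x z = 3" using d3[OF V(1,3)] by linarith
  then show ?thesis using V by (simp add: same_def)
qed (use assms in \<open>auto simp: same_def\<close>)

lemma same_not_adj: "same x y \<Longrightarrow> \<not> adj x y"
  using d_adj[of x y] adj_irrefl by (auto simp: same_def)

lemma same_unique:
  assumes "adj x y" "adj x z" "same y z" shows "y = z"
proof (rule ccontr)
  assume "y \<noteq> z"
  then have "d y z = 3" using assms by (simp add: same_def)
  moreover have "x \<in> cn y z" using assms adj_sym by (simp add: cn_def nb_def)
  ultimately show False using cn_far[of y z] assms(3) by (auto simp: same_def)
qed

lemma block_eq: "x \<in> V \<Longrightarrow> y \<in> V \<Longrightarrow> block x = block y \<longleftrightarrow> same x y"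
proof
  assume "x \<in> V" "y \<in> V" "block x = block y"
  moreover from this have "y \<in> block y" by (simp add: block_def same_def)
  ultimately show "same x y" by (auto simp: block_def)
next
  assume "same x y"
  then show "block x = block y" unfolding block_def using same_sym same_trans by blast
qed

lemma in_blocks: "X \<in> blocks \<Longrightarrow> x \<in> X \<Longrightarrow> x \<in> V \<and> X = block x"
  using block_eq by (auto simp: blocks_def block_def same_def)

text \<open>A neighbour of \<open>u\<close> at distance 3 from \<open>v\<close> shares no neighbour
  with \<open>v\<close>, and every other one shares 2(n - 1).\<close>

lemma sum_cn_nb:
  assumes u: "u \<in> V" and v: "v \<in> V" and d2: "d u v = 2"
  shows "(\<Sum>z\<in>nb u. card (cn v z)) = 2 * (n - 1) * (n ^ 2 - card (nxt v u))"
proof -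
  have dvu: "d v u = 2" using d2 d_sym[OF u v] by simp
  have sub: "nxt v u \<subseteq> nb u" by (auto simp: nxt_def)
  have "(\<Sum>z\<in>nb u. card (cn v z)) = (\<Sum>z\<in>nb u - nxt v u. card (cn v z))"
  proof (rule sum.mono_neutral_right)
    show "\<forall>z\<in>nb u - (nb u - nxt v u). card (cn v z) = 0"
      using cn_far[OF v] dvu by (auto simp: nxt_def)
  qed auto
  also have "\<dots> = (\<Sum>z\<in>nb u - nxt v u. 2 * (n - 1))"
  proof (rule sum.cong)
    fix z assume z: "z \<in> nb u - nxt v u"
    then have "adj u z" by (simp add: nb_def)
    then have "z \<in> V" "z \<noteq> v" using adj_in_V' d_adj d2 by auto
    moreover have "d v z \<noteq> 3" using z dvu by (auto simp: nxt_def)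
    ultimately show "card (cn v z) = 2 * (n - 1)" using card_cn_near[OF v, of z] by blast
  qed simp
  also have "\<dots> = 2 * (n - 1) * card (nb u - nxt v u)" by (simp add: mult.commute)
  also have "card (nb u - nxt v u) = n ^ 2 - card (nxt v u)"
    using card_Diff_subset[OF finite_subset[OF sub finite_nb] sub] card_nb[OF u] by simp
  finally show ?thesis .
qed

text \<open>The sum in \<open>sum_cn_nb\<close> counts walks of length 3 from \<open>u\<close> to \<open>v\<close>, so it is symmetric.\<close>

lemma card_nxt_commute:
  assumes u: "u \<in> V" and v: "v \<in> V" and d2: "d u v = 2"
  shows "card (nxt u v) = card (nxt v u)"
proof -
  have dvu: "d v u = 2" using d2 d_sym[OF u v] by simp
  have cn: "card (cn p q) = card {w \<in> nb p. adj q w}" for p q by (simp add: cn_def nb_def Int_def)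
  have "(\<Sum>z\<in>nb u. card {w \<in> nb v. adj z w}) = (\<Sum>w\<in>nb v. card (cn u w))"
  proof (rule sum_multicount_gen; (intro ballI)?)
    fix w
    show "card {z \<in> nb u. adj z w} = card (cn u w)"
      using adj_sym by (intro arg_cong[of _ _ card]) (auto simp: cn_def nb_def)
  qed simp_all
  then have "(\<Sum>z\<in>nb u. card (cn v z)) = (\<Sum>w\<in>nb v. card (cn u w))"
    by (simp only: cn[of v])
  then have "2 * (n - 1) * (n ^ 2 - card (nxt v u)) = 2 * (n - 1) * (n ^ 2 - card (nxt u v))"
    using sum_cn_nb[OF u v d2] sum_cn_nb[OF v u dvu] by simp
  then have "n ^ 2 - card (nxt v u) = n ^ 2 - card (nxt u v)" using n_ge_2 by simp
  moreover have "card (nxt v u) \<le> n ^ 2" "card (nxt u v) \<le> n ^ 2"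
    using card_nb[OF u] card_nb[OF v] card_mono[of "nb u" "nxt v u"] card_mono[of "nb v" "nxt u v"]
    by (auto simp: nxt_def)
  ultimately show ?thesis by linarith
qed

text \<open>If \<open>x'\<close> is antipodal to \<open>x\<close>, then \<open>x\<close> lies in
  \<open>nxt x' y\<close>. By \<open>card_nxt_commute\<close> the set \<open>nxt y x'\<close> is
  nonempty too, and its element is the required \<open>y'\<close>. Together with
  \<open>same_unique\<close> this gives perfect matchings between adjacent classes.\<close>

lemma adj_lift:
  assumes adj: "adj x y" and s: "same x x'"
  obtains y' where "same y y'" "adj x' y'"
proof (cases "x = x'")
  case True
  then show thesis using that[of y] adj adj_in_V' by (auto simp: same_def)
next
  case False
  then have V: "x \<in> V" "x' \<in> V" "y \<in> V" and d: "d x' x = 3"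
    using s same_sym[OF s] adj_in_V'[OF adj] by (auto simp: same_def)
  have d2: "d x' y = 2" using nb_antipode[OF big V(2,1) d adj] .
  then have "x \<in> nxt x' y" using d adj_sym[OF adj] by (simp add: nxt_def nb_def)
  then have "0 < card (nxt x' y)" by (auto simp: card_gt_0_iff nxt_def)
  then have "0 < card (nxt y x')" using card_nxt_commute[OF V(2,3) d2] by simp
  then have "nxt y x' \<noteq> {}" by (auto simp: card_gt_0_iff)
  then obtain y' where y': "adj x' y'" "d y y' = Suc (d y x')" by (auto simp: nxt_def nb_def)
  then have "same y y'" using d2 d_sym[OF V(2,3)] V adj_in_V'[OF y'(1)] by (simp add: same_def)
  then show thesis using that y' by blast
qed

section \<open>The quotient graph on the antipodal classes\<close>

definition qadj :: "'a set \<Rightarrow> 'a set \<Rightarrow> bool" where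
  "qadj X Y \<longleftrightarrow> X \<in> blocks \<and> Y \<in> blocks \<and> (\<exists>x\<in>X. \<exists>y\<in>Y. adj x y)"

lemma qadj_lift:
  assumes "qadj X Y" "x \<in> X" obtains y where "y \<in> Y" "adj x y"
proof -
  obtain x' y' where xy: "x' \<in> X" "y' \<in> Y" "adj x' y'" using assms by (auto simp: qadj_def)
  have "same x' x" using in_blocks[of X x'] assms xy by (auto simp: qadj_def block_def)
  then obtain y where "same y' y" "adj x y" using adj_lift[OF xy(3)] by blast
  moreover have "Y = block y'" using in_blocks[of Y y'] assms xy by (auto simp: qadj_def)
  ultimately show thesis using that by (auto simp: block_def)
qed

lemma block_in_blocks: "x \<in> V \<Longrightarrow> block x \<in> blocks"
  by (simp add: blocks_def)

lemma self_in_block: "x \<in> V \<Longrightarrow> x \<in> block x"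
  by (simp add: block_def same_def)

lemma qadj_block:
  assumes x: "x \<in> V"
  shows "{Y \<in> blocks. qadj (block x) Y} = block ` nb x"
proof (intro equalityI subsetI)
  fix Y assume "Y \<in> {Y \<in> blocks. qadj (block x) Y}"
  then have Y: "Y \<in> blocks" "qadj (block x) Y" by auto
  obtain y where "y \<in> Y" "adj x y" using qadj_lift[OF Y(2) self_in_block[OF x]] .
  then show "Y \<in> block ` nb x" using in_blocks[OF Y(1)] by (auto simp: nb_def)
next
  fix Y assume "Y \<in> block ` nb x"
  then obtain y where y: "adj x y" "Y = block y" by (auto simp: nb_def)
  then show "Y \<in> {Y \<in> blocks. qadj (block x) Y}"
    using x adj_in_V'[OF y(1)] block_in_blocks self_in_block by (auto simp: qadj_def)
qed

lemma inj_on_block_nb: "inj_on block (nb x)"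
  using same_unique block_eq adj_in_V' by (auto simp: inj_on_def nb_def)

text \<open>For a fixed \<open>x\<close> in \<open>X\<close>, the common neighbours of the classes
  \<open>X\<close> and \<open>Y\<close> correspond to the common neighbours of \<open>x\<close> with
  the \<open>r\<close> members of \<open>Y\<close>. These sets are disjoint, because antipodal
  vertices have no common neighbour, and each has 2(n - 1) elements.\<close>

sublocale quotient: polarity_graph blocks qadj "n ^ 2" "2 * (n - 1) * r"
proof
  show "finite blocks" using finite_V by (simp add: blocks_def)
  show "blocks \<noteq> {}" using V_nonempty by (simp add: blocks_def)
  fix X Y
  show "qadj X Y \<Longrightarrow> qadj Y X" using adj_sym by (auto simp: qadj_def)
  show "\<not> qadj X X"
  proof
    assume "qadj X X"
    then obtain x y where "x \<in> X" "y \<in> X" "adj x y" "X \<in> blocks" by (auto simp: qadj_def)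
    then show False using in_blocks[of X x] same_not_adj by (auto simp: block_def)
  qed
  assume X: "X \<in> blocks"
  then obtain x where x: "x \<in> V" "X = block x" by (auto simp: blocks_def)
  show "card {Y \<in> blocks. qadj X Y} = n ^ 2"
    unfolding x(2) qadj_block[OF x(1)] by (simp add: card_image inj_on_block_nb card_nb[OF x(1)])
  assume Y: "Y \<in> blocks" and ne: "X \<noteq> Y"
  have YV: "y \<in> V" "Y = block y" if "y \<in> Y" for y using in_blocks[OF Y that] by auto
  have "{Z \<in> blocks. qadj X Z \<and> qadj Z Y} = block ` (\<Union>y\<in>Y. cn x y)"
  proof (intro equalityI subsetI)
    fix Z assume Z: "Z \<in> {Z \<in> blocks. qadj X Z \<and> qadj Z Y}"
    then obtain z where z: "z \<in> Z" "adj x z" using qadj_lift[of X Z x] x self_in_block by auto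
    then obtain y where "y \<in> Y" "adj z y" using qadj_lift[of Z Y z] Z by auto
    then have "z \<in> (\<Union>y\<in>Y. cn x y)" using z adj_sym by (auto simp: cn_def nb_def)
    moreover have "Z = block z" using in_blocks[of Z z] Z z by auto
    ultimately show "Z \<in> block ` (\<Union>y\<in>Y. cn x y)" by blast
  next
    fix Z assume "Z \<in> block ` (\<Union>y\<in>Y. cn x y)"
    then obtain z y where z: "Z = block z" "y \<in> Y" "adj x z" "adj z y"
      using adj_sym by (auto simp: cn_def nb_def)
    have zV: "z \<in> V" using z adj_in_V by blast
    then show "Z \<in> {Z \<in> blocks. qadj X Z \<and> qadj Z Y}"
      using z x X Y block_in_blocks self_in_block[OF x(1)] self_in_block[OF zV] by (auto simp: qadj_def)
  qed
  then have "card {Z \<in> blocks. qadj X Z \<and> qadj Z Y} = card (\<Union>y\<in>Y. cn x y)"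
    using inj_on_subset[OF inj_on_block_nb[of x], of "\<Union>y\<in>Y. cn x y"]
    by (simp add: card_image cn_def subset_eq)
  also have "\<dots> = (\<Sum>y\<in>Y. card (cn x y))"
  proof (rule card_UN_disjoint)
    show "finite Y" using finite_subset[OF _ finite_V] YV by blast
    show "\<forall>y\<in>Y. \<forall>y'\<in>Y. y \<noteq> y' \<longrightarrow> cn x y \<inter> cn x y' = {}"
    proof (intro ballI impI, rule ccontr)
      fix y y' assume y: "y \<in> Y" "y' \<in> Y" "y \<noteq> y'" and "cn x y \<inter> cn x y' \<noteq> {}"
      then obtain z where "adj z y" "adj z y'" using adj_sym by (auto simp: cn_def nb_def)
      moreover have "same y y'" using YV y block_eq by metis
      ultimately show False using same_unique y(3) by blast
    qed
  qed simp
  also have "\<dots> = (\<Sum>y\<in>Y. 2 * (n - 1))"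
  proof (rule sum.cong)
    fix y assume y: "y \<in> Y"
    then have "\<not> same x y" using block_eq YV x ne by metis
    then show "card (cn x y) = 2 * (n - 1)"
      using card_cn_near[OF x(1) YV(1)[OF y]] x YV(1)[OF y] by (auto simp: same_def)
  qed simp
  also have "\<dots> = 2 * (n - 1) * r"
    using Y card_block by (auto simp: blocks_def)
  finally show "card {Z \<in> blocks. qadj X Z \<and> qadj Z Y} = 2 * (n - 1) * r" .
qed

lemma card_blocks: "n ^ 2 * (n + 1) = 2 * r * (card blocks - 1)"
proof -
  have "n ^ 2 * (n ^ 2 - 1) = 2 * (n - 1) * r * (card blocks - 1)" by (rule quotient.count)
  moreover have "n ^ 2 - 1 = (n - 1) * (n + 1)" by (cases n) (auto simp: power2_eq_square)
  ultimately have "(n - 1) * (n ^ 2 * (n + 1)) = (n - 1) * (2 * r * (card blocks - 1))"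
    by (simp only: mult_ac)
  then show ?thesis using n_ge_2 by simp
qed

section \<open>Cliques at distance 2 from a vertex, and divisibility by \<open>2 * r\<close>\<close>

lemma missing_row_unique:
  assumes w: "w \<in> V" "x \<in> V" "d w x = 2"
    and a: "a \<in> {1..n}" "a \<notin> rw w ` cn w x" and b: "b \<in> {1..n}" "b \<notin> rw w ` cn w x"
  shows "a = b"
proof -
  have "card (rw w ` cn w x) = n - 1" using card_cn_eq_rows[OF w] mu_eq[OF w] by simp
  then have c: "card ({1..n} - rw w ` cn w x) \<le> 1"
    using rw_cn_subset by (subst card_Diff_subset) auto
  have "card {a, b} \<le> card ({1..n} - rw w ` cn w x)" by (rule card_mono) (use a b in auto)
  with c have "card {a, b} \<le> 1" by (rule order_trans[rotated])
  then show ?thesis by (cases "a = b") simp_all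
qed

lemma missing_row_ex:
  assumes w: "w \<in> V" "x \<in> V" "d w x = 2"
  obtains a where "a \<in> {1..n}" "a \<notin> rw w ` cn w x"
proof -
  have "card (rw w ` cn w x) = n - 1" using card_cn_eq_rows[OF w] mu_eq[OF w] by simp
  then have "rw w ` cn w x \<noteq> {1..n}" using n_ge_2 by auto
  then show thesis using that rw_cn_subset by blast
qed

text \<open>A clique of order \<open>n + 1\<close> at distance 2 from \<open>x\<close> is, around each of its vertices \<open>w\<close>, the
  unique row or column missed by the \<open>\<mu>\<close>-graph, hence contains the only possible neighbour of \<open>w\<close> at
  distance 3 from \<open>x\<close>.\<close>

lemma far_row_antipode:
  assumes w: "w \<in> V" "x \<in> V" "d w x = 2" and a: "a \<in> {1..n}"
    and far: "\<And>t. t \<in> nb w \<Longrightarrow> rw w t = a \<Longrightarrow> \<not> adj x t"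
    and z: "adj w z" "d x z = 3"
  shows "rw w z = a"
proof (rule missing_row_unique[OF w])
  show "a \<notin> rw w ` cn w x" using far by (auto simp: cn_def nb_def)
  have dxw: "d x w = 2" using w d_sym by simp
  have "z \<in> nxt x w" using z dxw by (simp add: nxt_def nb_def)
  then show "rw w z \<notin> rw w ` cn w x"
    using nxt_row_disjoint[OF w(2)] prv_2[OF w(2) dxw] cn_commute by blast
  show "rw w z \<in> {1..n}" using coords_range z by blast
qed (rule a)

lemma far_clq_antipode:
  assumes C: "clq C" and x: "x \<in> V" and far: "\<And>w. w \<in> C \<Longrightarrow> d x w = 2"
    and w: "w \<in> C" and z: "adj w z" "d x z = 3"
  shows "z \<in> C"
proof -
  have wV: "w \<in> V" using C w by (auto simp: clq_def)
  have dwx: "d w x = 2" using far[OF w] d_sym[OF x wV] by simp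
  have nadj: "\<not> adj x t" if "t \<in> C" for t using far[OF that] d_adj by fastforce
  from C w show ?thesis
  proof (cases rule: clq_line_cases)
    case (1 a)
    have "rw w z = a"
      by (rule far_row_antipode[OF wV x dwx 1(1) _ z]) (use nadj 1(2) in blast)
    then show ?thesis using 1(2) z by (simp add: nb_def)
  next
    case (2 a)
    interpret s: tight_local_grid V adj n d cl rw by (rule swap_tight)
    have "cl w z = a"
      by (rule s.far_row_antipode[OF wV x dwx 2(1) _ z]) (use nadj 2(2) in blast)
    then show ?thesis using 2(2) z by (simp add: nb_def)
  qed
qed

text \<open>Let \<open>T\<close> be the set of vertices outside a clique \<open>C\<close> of order n
  + 1 with a neighbour in it. Each has exactly two, which gives 2 |T| = (n + 1)(n^2 - n); and
  \<open>T\<close> is a union of antipodal classes, so r divides |T|.\<close>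

lemma dvd_clique_neighbours: "2 * r dvd (n + 1) * n * (n - 1)"
proof -
  obtain y where y: "y \<in> V" using V_nonempty by blast
  define C where "C = insert y {t \<in> nb y. rw y t = 1}"
  have C: "clq C" unfolding C_def by (rule clq_row[OF y]) (use n_ge_2 in auto)
  then have CV: "C \<subseteq> V" and cardC: "card C = n + 1"
    and adjC: "\<And>p q. p \<in> C \<Longrightarrow> q \<in> C \<Longrightarrow> p \<noteq> q \<Longrightarrow> adj p q" by (auto simp: clq_def)
  note finC = finite_clq[OF C]
  define T where "T = {v \<in> V - C. \<exists>w\<in>C. adj v w}"
  have finT: "finite T" using finite_V by (simp add: T_def)
  have "(\<Sum>w\<in>C. card {v \<in> T. adj v w}) = (\<Sum>v\<in>T. 2)"
    by (rule sum_multicount_gen) (use finC finT clq_two[OF C] in \<open>auto simp: T_def\<close>)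
  moreover have "(\<Sum>w\<in>C. card {v \<in> T. adj v w}) = (\<Sum>w\<in>C. n ^ 2 - n)"
  proof (rule sum.cong)
    fix w assume w: "w \<in> C"
    have "{v \<in> T. adj v w} = nb w - (C - {w})"
      using w adj_sym adj_irrefl adj_in_V' by (auto simp: T_def nb_def)
    moreover have "C - {w} \<subseteq> nb w" using adjC w by (auto simp: nb_def)
    ultimately have "card {v \<in> T. adj v w} = card (nb w) - card (C - {w})"
      using finC by (simp add: card_Diff_subset)
    then show "card {v \<in> T. adj v w} = n ^ 2 - n" using card_nb[of w] w CV cardC finC by auto
  qed simp
  ultimately have T: "2 * card T = (n + 1) * (n ^ 2 - n)" using cardC by (simp add: mult.commute)
  have closed: "v' \<in> T" if v: "v \<in> T" and s: "same v v'" for v v'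
  proof (cases "v = v'")
    case False
    then have V: "v \<in> V" "v' \<in> V" "d v' v = 3" using s same_sym[OF s] by (auto simp: same_def)
    obtain u where u: "u \<in> C" "adj v u" "v \<notin> C" using v by (auto simp: T_def)
    have uV: "u \<in> V" using u CV by blast
    have near: "d u v' = 2" using nb_antipode[OF big V(2,1,3) u(2)] d_sym[of u v'] u CV V by auto
    have "u \<noteq> v'" using near d_eq_0[OF uV uV] by auto
    then have notC: "v' \<notin> C" using adjC[OF u(1), of v'] near d_adj[of u v'] by auto
    show ?thesis
    proof (rule ccontr)
      assume "v' \<notin> T"
      then have nadj: "\<not> adj v' w" if "w \<in> C" for w using that notC V by (auto simp: T_def)
      \<comment> \<open>If \<open>v'\<close> were antipodal to some \<open>w\<close> in
        \<open>C\<close>, then so would be \<open>v\<close>; but \<open>v\<close> is adjacent to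
        \<open>u\<close>, which is equal or adjacent to \<open>w\<close>. So all of \<open>C\<close>
        is at distance 2 from \<open>v'\<close>, and \<open>far_clq_antipode\<close> puts
        \<open>v\<close> into \<open>C\<close>.\<close>
      have "d v' w = 2" if w: "w \<in> C" for w
      proof -
        have wV: "w \<in> V" using w CV by blast
        have "d v' w \<noteq> 0" "d v' w \<noteq> 1"
          using nadj[OF w] notC w d_eq_0[OF V(2) wV] d_1_adj[OF V(2) wV] by auto
        moreover have "d v' w \<noteq> 3"
        proof
          assume w3: "d v' w = 3"
          then have "same v' w" using V wV by (simp add: same_def)
          then have vw: "same v w" using same_trans[OF s] by blast
          show False
          proof (cases "u = w")
            case True
            then show False using same_not_adj[OF vw] u by blast
          next
            case False
            then have "adj u w" using adjC u w by blast
            then show False using same_unique[OF adj_sym[OF u(2)] _ vw] u w by blast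
          qed
        qed
        ultimately show ?thesis using d3[OF V(2) wV] by linarith
      qed
      then have "v \<in> C" using far_clq_antipode[OF C V(2) _ u(1) adj_sym[OF u(2)] V(3)] by blast
      then show False using u by blast
    qed
  qed (use v in simp)
  define R where "R = {(v, v'). v \<in> T \<and> same v v'}"
  have "equiv T R"
  proof (rule equivI)
    show "R \<subseteq> T \<times> T" using closed by (auto simp: R_def)
    show "refl_on T R" by (auto simp: refl_on_def R_def T_def same_def)
    show "sym R" using closed same_sym by (auto simp: sym_def R_def)
    show "trans R" using same_trans by (auto simp: trans_def R_def)
  qed
  moreover have "r dvd card X" if "X \<in> T // R" for X
  proof -
    obtain v where v: "v \<in> T" "X = R `` {v}" using \<open>X \<in> T // R\<close> by (rule quotientE)
    then have "X = block v" by (auto simp: R_def block_def)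
    then show ?thesis using card_block[of v] v by (simp add: T_def)
  qed
  ultimately have "r dvd card T" by (rule equiv_imp_dvd_card[OF finT])
  then have "2 * r dvd 2 * card T" by simp
  moreover have "n ^ 2 - n = n * (n - 1)" by (simp add: power2_eq_square diff_mult_distrib2)
  ultimately show ?thesis unfolding T by (simp only: mult.assoc)
qed

text \<open>Difference of two known multiples: n^2 (n + 1) from \<open>card_blocks\<close> and (n +
  1) n (n - 1) from the clique.\<close>

lemma dvd_r: "2 * r dvd n * (n + 1)"
proof -
  have "2 * r dvd n ^ 2 * (n + 1)" using card_blocks by simp
  then have "2 * r dvd n ^ 2 * (n + 1) - (n + 1) * n * (n - 1)"
    using dvd_clique_neighbours by (rule dvd_diff_nat)
  moreover have "n ^ 2 * (n + 1) - (n + 1) * n * (n - 1) = n * (n + 1)"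
    by (cases n) (simp_all add: power2_eq_square algebra_simps)
  ultimately show ?thesis by simp
qed

text \<open>A vertex \<open>z\<close> of the missed row shares with \<open>w\<close> a neighbour
  adjacent to \<open>x\<close> exactly when the column of \<open>z\<close> is met by the mu-graph.
  Only one column is not met.\<close>

lemma missed_row_partner:
  assumes w: "w \<in> V" "x \<in> V" "d w x = 2" and a: "a \<in> {1..n}" "a \<notin> rw w ` cn w x"
  shows "\<exists>!z. z \<in> nb w \<and> rw w z = a \<and> cn w z \<inter> nb x = {}"
proof -
  have iff: "cn w z \<inter> nb x = {} \<longleftrightarrow> cl w z \<notin> cl w ` cn w x" if z: "adj w z" "rw w z = a" for z
  proof -
    have "adj z s \<longleftrightarrow> cl w z = cl w s" if s: "s \<in> cn w x" for s
    proof -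
      have "adj w s" "rw w s \<noteq> a" using s a by (auto simp: cn_def nb_def)
      then show ?thesis using grid_adj[OF z(1)] z(2) by auto
    qed
    then show ?thesis by (auto simp: cn_def nb_def)
  qed
  interpret s: tight_local_grid V adj n d cl rw by (rule swap_tight)
  obtain b where b: "b \<in> {1..n}" "b \<notin> cl w ` cn w x" using s.missing_row_ex[OF w] by auto
  obtain z where z: "adj w z" "rw w z = a" "cl w z = b" using coords_ex[OF w(1) a(1) b(1)] .
  show ?thesis
  proof (rule ex1I[of _ z])
    show "z \<in> nb w \<and> rw w z = a \<and> cn w z \<inter> nb x = {}" using iff z b by (auto simp: nb_def)
    fix z' assume "z' \<in> nb w \<and> rw w z' = a \<and> cn w z' \<inter> nb x = {}"
    then have z': "adj w z'" "rw w z' = a" "cl w z' \<notin> cl w ` cn w x" using iff by (auto simp: nb_def)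
    have "cl w z' = b"
      using s.missing_row_unique[OF w, of "cl w z'" b] z' b coords_range(2)[OF z'(1)] by auto
    then show "z' = z" using coords_inj[OF z'(1) z(1)] z' z by simp
  qed
qed

text \<open>If a clique of order \<open>n + 1\<close> lies entirely at distance 2 from \<open>x\<close>, then pairing its vertices
  without common neighbours in the neighbourhood of \<open>x\<close> is a perfect matching.\<close>

lemma far_clq_odd:
  assumes C: "clq C" and x: "x \<in> V" and far: "\<And>w. w \<in> C \<Longrightarrow> d x w = 2"
  shows "odd n"
proof -
  have nadj: "\<not> adj x t" if "t \<in> C" for t using far[OF that] d_adj by fastforce
  have "even (card C)"
  proof (rule even_card_perfect_matching[of _ "\<lambda>w z. w \<noteq> z \<and> cn w z \<inter> nb x = {}"])
    fix w assume w: "w \<in> C"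
    then have wV: "w \<in> V" using C by (auto simp: clq_def)
    have dwx: "d w x = 2" using far[OF w] d_sym[OF x wV] by simp
    have wnb: "w \<notin> nb w" using adj_irrefl by (simp add: nb_def)
    from C w show "\<exists>!z. z \<in> C \<and> w \<noteq> z \<and> cn w z \<inter> nb x = {}"
    proof (cases rule: clq_line_cases)
      case (1 a)
      have a: "a \<notin> rw w ` cn w x" using nadj 1(2) by (auto simp: cn_def nb_def)
      have "z \<in> C \<and> w \<noteq> z \<and> P \<longleftrightarrow> z \<in> nb w \<and> rw w z = a \<and> P" for z P using 1(2) wnb by auto
      then show ?thesis using missed_row_partner[OF wV x dwx 1(1) a] by simp
    next
      case (2 a)
      interpret s: tight_local_grid V adj n d cl rw by (rule swap_tight)
      have a: "a \<notin> cl w ` cn w x" using nadj 2(2) by (auto simp: cn_def nb_def)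
      have "z \<in> C \<and> w \<noteq> z \<and> P \<longleftrightarrow> z \<in> nb w \<and> cl w z = a \<and> P" for z P using 2(2) wnb by auto
      then show ?thesis using s.missed_row_partner[OF wV x dwx 2(1) a] by simp
    qed
  qed (use finite_clq[OF C] cn_commute in auto)
  then show ?thesis using C by (simp add: clq_def)
qed

section \<open>Parity of \<open>n\<close>, size of the classes and completeness of the
  quotient\<close>

lemma qadj_complete:
  assumes card: "card blocks \<le> n ^ 2 + 1" and X: "X \<in> blocks" and Y: "Y \<in> blocks" and ne: "X \<noteq> Y"
  shows "qadj X Y"
proof (rule ccontr)
  assume nq: "\<not> qadj X Y"
  have "{Z \<in> blocks. qadj X Z} \<subseteq> blocks - {X, Y}" using nq quotient.R_irrefl by auto
  then have "n ^ 2 \<le> card (blocks - {X, Y})"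
    using quotient.R_degree[OF X] card_mono[of "blocks - {X, Y}" "{Z \<in> blocks. qadj X Z}"] quotient.finite_X
    by simp
  also have "card (blocks - {X, Y}) = card blocks - 2"
    using X Y ne by (simp add: card_Diff_subset)
  finally have "n ^ 2 \<le> card blocks - 2" .
  moreover have "0 < n ^ 2" using n_ge_2 by simp
  ultimately show False using card by linarith
qed

lemma odd_n: "odd n"
proof (rule ccontr)
  assume even: "\<not> odd n"
  then have r: "2 * r \<le> n" using r_le by presburger
  have n0: "0 < n" using n_ge_2 by simp
  \<comment> \<open>With 2r at most n, \<open>card_blocks\<close> forces more than n^2 + 1 classes,
    so some class \<open>Y\<close> is not adjacent to \<open>X\<close>.\<close>
  have "n ^ 2 < card blocks - 1"
  proof (rule ccontr)
    assume "\<not> n ^ 2 < card blocks - 1"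
    then have "2 * r * (card blocks - 1) \<le> n * n ^ 2" using r by (intro mult_le_mono) auto
    moreover have "n * n ^ 2 < n ^ 2 * (n + 1)" using n0 by simp
    ultimately show False using card_blocks by linarith
  qed
  moreover obtain X where X: "X \<in> blocks" using quotient.X_nonempty by blast
  moreover have "card (blocks - {X}) = card blocks - 1" using X by simp
  ultimately have "\<not> blocks - {X} \<subseteq> {Y \<in> blocks. qadj X Y}"
    using card_mono[of "{Y \<in> blocks. qadj X Y}" "blocks - {X}"] quotient.R_degree[OF X] quotient.finite_X
    by auto
  then obtain Y where Y: "Y \<in> blocks" "Y \<noteq> X" "\<not> qadj X Y" by blast
  obtain x y where x: "x \<in> V" "X = block x" and y: "y \<in> V" "Y = block y"
    using X Y by (auto simp: blocks_def)
  have nadj: "\<not> adj x' y" if "same x x'" for x'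
    using that Y(1,3) X self_in_block[OF y(1)] x y by (auto simp: qadj_def block_def)
  have "\<not> same x y" using block_eq x y Y(2) by blast
  then have "d x y \<noteq> 0" "d x y \<noteq> 1" "d x y \<noteq> 3"
    using x y nadj[of x] d_eq_0[OF x(1) y(1)] d_1_adj[OF x(1) y(1)] by (auto simp: same_def)
  then have d2: "d x y = 2" using d3[OF x(1) y(1)] by linarith
  then have dyx: "d y x = 2" using d_sym[OF x(1) y(1)] by simp
  obtain a where a: "a \<in> {1..n}" "a \<notin> rw y ` cn y x" using missing_row_ex[OF y(1) x(1) dyx] .
  \<comment> \<open>The row missed by the mu-graph, together with \<open>y\<close>, is a clique
    without neighbours of \<open>x\<close>; by \<open>nadj\<close> it contains no vertex antipodal
    to \<open>x\<close> either. Hence it lies entirely at distance 2.\<close>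
  have "odd n"
  proof (rule far_clq_odd[OF clq_row[OF y(1) a(1)] x(1)])
    fix w assume w: "w \<in> insert y {t \<in> nb y. rw y t = a}"
    show "d x w = 2"
    proof (cases "w = y")
      case False
      then have yw: "adj y w" "rw y w = a" using w by (auto simp: nb_def)
      then have wV: "w \<in> V" by (auto intro: adj_in_V')
      have "d x w \<noteq> 0" using d_eq_0[OF x(1) wV] yw(1) d_adj dyx by auto
      moreover have "d x w \<noteq> 1"
      proof
        assume "d x w = 1"
        then have "w \<in> cn y x" using yw d_1_adj[OF x(1) wV] by (simp add: cn_def nb_def)
        then show False using a(2) yw(2) by blast
      qed
      moreover have "d x w \<noteq> 3"
      proof
        assume "d x w = 3"
        then have "same x w" using x wV by (simp add: same_def)
        then show False using nadj adj_sym[OF yw(1)] by blast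
      qed
      ultimately show ?thesis using d3[OF x(1) wV] by linarith
    qed (use d2 in simp)
  qed
  then show False using even by blast
qed

lemma r_eq: "2 * r = n + 1"
proof (rule fibre_size_unique[OF odd_n n_ge_2 dvd_r r_le])
  fix p :: nat assume p: "prime p" "p dvd n ^ 2 - 2 * (n - 1) * r"
  \<comment> \<open>The inequality shows that the subtraction in \<open>p\<close> is not truncated,
    so divisibility becomes the congruence required by
    \<open>quotient.prime_dvd_degree\<close>.\<close>
  have "2 * (n - 1) * r = (n - 1) * (2 * r)" by simp
  also have "\<dots> \<le> (n - 1) * (n + 1)" using r_le by (rule mult_le_mono2)
  also have "\<dots> \<le> n ^ 2" by (cases n) (auto simp: power2_eq_square)
  finally have "[2 * (n - 1) * r = n ^ 2] (mod p)"
    using p(2) cong_altdef_nat cong_sym by blast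
  then have "p dvd n ^ 2" by (rule quotient.prime_dvd_degree[OF p(1)])
  then show "p dvd n" using p(1) prime_dvd_power by blast
qed

lemma card_blocks_eq: "card blocks = n ^ 2 + 1"
proof -
  have "(n + 1) * n ^ 2 = (n + 1) * (card blocks - 1)"
    using card_blocks unfolding r_eq by (simp add: mult.commute)
  then have "card blocks - 1 = n ^ 2" by (simp only: mult_cancel1) simp
  moreover have "0 < card blocks" using quotient.finite_X quotient.X_nonempty by (simp add: card_gt_0_iff)
  ultimately show ?thesis by linarith
qed

lemma card_V_eq: "2 * card V = (n ^ 2 + 1) * (n + 1)"
  using card_V_r unfolding r_eq by (simp add: algebra_simps)

lemma qadj_all: "X \<in> blocks \<Longrightarrow> Y \<in> blocks \<Longrightarrow> X \<noteq> Y \<Longrightarrow> qadj X Y"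
  using qadj_complete card_blocks_eq by simp

text \<open>The quotient is complete, so \<open>y\<close> has a neighbour in the class of
  \<open>x\<close>; it is not \<open>x\<close>, hence it is at distance 3 from
  \<open>x\<close>.\<close>

lemma card_nxt_eq:
  assumes x: "x \<in> V" and y: "y \<in> V" and d2: "d x y = 2"
  shows "card (nxt x y) = 1"
proof -
  have "\<not> same x y" using d2 d_eq_0[OF x y] by (auto simp: same_def)
  then have "block y \<noteq> block x" using block_eq x y same_sym by blast
  then have "qadj (block y) (block x)" using qadj_all block_in_blocks x y by blast
  then obtain z where z: "z \<in> block x" "adj y z" using qadj_lift self_in_block[OF y] by blast
  then have "d x z = 3" using d2 d_adj[OF z(2)] d_sym[OF x y] by (auto simp: block_def same_def)
  then have "z \<in> nxt x y" using z d2 by (simp add: nxt_def nb_def)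
  then have "nxt x y \<noteq> {}" by blast
  then have "0 < card (nxt x y)" by (simp add: card_gt_0_iff nxt_def)
  then show ?thesis using card_nxt_2(1)[OF big x y d2] by linarith
qed

lemma antipode_ex: "\<exists>x\<in>V. \<exists>y\<in>V. d x y = 3"
proof -
  obtain x where x: "x \<in> V" using V_nonempty by blast
  have "n \<noteq> 2" using odd_n by auto
  then have "1 < r" using r_eq n_ge_2 by linarith
  then have "\<not> block x \<subseteq> {x}" using card_mono[of "{x}" "block x"] card_block[OF x] by auto
  then show ?thesis using x by (auto simp: block_def same_def)
qed

end

section \<open>Distances and isomorphisms of pair graphs\<close>

context pair_graph
begin

lemma sym_parcs: "(x, y) \<in> parcs G \<Longrightarrow> (y, x) \<in> parcs G"
  using sym_arcs by (auto simp: symmetric_def dest: symD)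

lemma awalk_rev:
  assumes "awalk x p y" shows "\<exists>q. awalk y q x \<and> length q = length p"
  using assms
proof (induction p arbitrary: x)
  case Nil
  then show ?case by (auto simp: awalk_Nil_iff intro!: exI[of _ "[]"])
next
  case (Cons e p)
  then have e: "e \<in> parcs G" "fst e = x" "awalk (snd e) p y" by (auto simp: awalk_Cons_iff)
  then obtain q where q: "awalk y q (snd e)" "length q = length p" using Cons.IH by blast
  have "(snd e, x) \<in> parcs G" using sym_parcs[of "fst e" "snd e"] e by (metis prod.collapse)
  then have "awalk (snd e) [(snd e, x)] x" by (auto simp: awalk_simps dest: in_arcsD2 in_arcsD1)
  with q(1) have "awalk y (q @ [(snd e, x)]) x" by (rule awalk_appendI)
  then show ?case using q(2) by (intro exI[of _ "q @ [(snd e, x)]"]) simp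
qed

end

locale connected_pair_graph = pair_graph +
  assumes conn: "Digraph_Component.connected (with_proj G)"
begin

lemma awalk_ex:
  assumes "x \<in> pverts G" "y \<in> pverts G" obtains p where "awalk x p y"
proof -
  have "strongly_connected (with_proj G)"
    using symmetric_connected_imp_strongly_connected[OF sym_arcs conn] .
  then have "x \<rightarrow>\<^sup>*\<^bsub>with_proj G\<^esub> y" using assms by (simp add: strongly_connected_def)
  then show thesis using that by (auto simp: reachable_awalk)
qed

lemma pverts_nonempty: "pverts G \<noteq> {}"
  using symmetric_connected_imp_strongly_connected[OF sym_arcs conn] by (simp add: strongly_connected_def)

lemma graph_dist_le: "awalk x p y \<Longrightarrow> graph_dist G x y \<le> length p"
  unfolding graph_dist_def by (rule cInf_lower) auto

lemma graph_dist_awalk: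
  assumes "x \<in> pverts G" "y \<in> pverts G"
  obtains p where "awalk x p y" "length p = graph_dist G x y"
proof -
  obtain p where "awalk x p y" using awalk_ex[OF assms] .
  then have "{length p | p. awalk x p y} \<noteq> {}" by blast
  then have "graph_dist G x y \<in> {length p | p. awalk x p y}"
    unfolding graph_dist_def by (rule Inf_nat_def1)
  then show thesis using that by auto
qed

lemma graph_dist_eq_0: "x \<in> pverts G \<Longrightarrow> y \<in> pverts G \<Longrightarrow> graph_dist G x y = 0 \<longleftrightarrow> x = y"
proof
  assume xy: "x \<in> pverts G" "y \<in> pverts G" "graph_dist G x y = 0"
  then obtain p where "awalk x p y" "length p = 0" using graph_dist_awalk[OF xy(1,2)] by metis
  then show "x = y" by (simp add: awalk_Nil_iff)
next
  assume "x \<in> pverts G" "x = y"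
  then have "awalk x [] y" by (simp add: awalk_Nil_iff)
  then show "graph_dist G x y = 0" using graph_dist_le[of x "[]" y] by simp
qed

lemma graph_dist_sym: "x \<in> pverts G \<Longrightarrow> y \<in> pverts G \<Longrightarrow> graph_dist G x y = graph_dist G y x"
proof -
  have "graph_dist G y x \<le> graph_dist G x y" if xy: "x \<in> pverts G" "y \<in> pverts G" for x y
  proof -
    obtain p where "awalk x p y" "length p = graph_dist G x y" using graph_dist_awalk[OF xy] .
    then obtain q where "awalk y q x" "length q = graph_dist G x y" using awalk_rev[of x p y] by auto
    then show ?thesis using graph_dist_le[of y q x] by simp
  qed
  then show "x \<in> pverts G \<Longrightarrow> y \<in> pverts G \<Longrightarrow> ?thesis" by (simp add: antisym)
qed

lemma graph_dist_triangle:
  assumes "x \<in> pverts G" "y \<in> pverts G" "z \<in> pverts G"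
  shows "graph_dist G x z \<le> graph_dist G x y + graph_dist G y z"
proof -
  obtain p where p: "awalk x p y" "length p = graph_dist G x y" using graph_dist_awalk[OF assms(1,2)] .
  obtain q where q: "awalk y q z" "length q = graph_dist G y z" using graph_dist_awalk[OF assms(2,3)] .
  show ?thesis using graph_dist_le[OF awalk_appendI[OF p(1) q(1)]] p q by simp
qed

lemma graph_dist_adj: "(x, y) \<in> parcs G \<Longrightarrow> graph_dist G x y = 1"
proof -
  assume xy: "(x, y) \<in> parcs G"
  then have V: "x \<in> pverts G" "y \<in> pverts G" by (auto dest: in_arcsD1 in_arcsD2)
  have "awalk x [(x, y)] y" using xy V by (simp add: awalk_simps)
  then have "graph_dist G x y \<le> 1" using graph_dist_le[of x "[(x, y)]" y] by simp
  moreover have "graph_dist G x y \<noteq> 0" using graph_dist_eq_0[OF V] no_loops'[OF xy] by simp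
  ultimately show ?thesis by linarith
qed

lemma graph_dist_pred:
  assumes V: "x \<in> pverts G" "y \<in> pverts G" and d: "graph_dist G x y = Suc i"
  shows "\<exists>z. (z, y) \<in> parcs G \<and> graph_dist G x z = i"
proof -
  obtain p where p: "awalk x p y" "length p = Suc i" using graph_dist_awalk[OF V] d by metis
  then obtain q e where qe: "p = q @ [e]" "length q = i" by (auto simp: length_Suc_conv_rev)
  then have e: "awalk x q (fst e)" "e \<in> parcs G" "snd e = y"
    using p(1) by (auto simp: awalk_simps)
  have ey: "(fst e, y) \<in> parcs G" using e by auto
  then have "fst e \<in> pverts G" by (rule in_arcsD1)
  then have "Suc i \<le> graph_dist G x (fst e) + 1"
    using graph_dist_triangle[OF V(1) _ V(2), of "fst e"] graph_dist_adj[OF ey] d by simp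
  moreover have "graph_dist G x (fst e) \<le> i" using graph_dist_le[OF e(1)] qe by simp
  ultimately show ?thesis using ey by (intro exI[of _ "fst e"]) simp
qed

lemma finite_dists: "finite {graph_dist G x y | x y. x \<in> pverts G \<and> y \<in> pverts G}"
proof -
  have "{graph_dist G x y | x y. x \<in> pverts G \<and> y \<in> pverts G}
      = (\<lambda>(x, y). graph_dist G x y) ` (pverts G \<times> pverts G)" by auto
  then show ?thesis using pair_finite_verts by simp
qed

lemma graph_dist_le_diameter: "x \<in> pverts G \<Longrightarrow> y \<in> pverts G \<Longrightarrow> graph_dist G x y \<le> diameter G"
  unfolding diameter_def by (rule Max_ge[OF finite_dists]) blast

lemma diameter_attained:
  obtains x y where "x \<in> pverts G" "y \<in> pverts G" "diameter G = graph_dist G x y"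
proof -
  have "diameter G \<in> {graph_dist G x y | x y. x \<in> pverts G \<and> y \<in> pverts G}"
    unfolding diameter_def by (rule Max_in[OF finite_dists]) (use pverts_nonempty in blast)
  then show thesis using that by blast
qed

end

text \<open>A library isomorphism maps vertices and arcs separately. Arcs of pair graphs are pairs
  with tail \<open>fst\<close> and head \<open>snd\<close>, so the arc map is determined by the
  vertex map.\<close>

lemma digraph_iso_pairD:
  assumes iso: "digraph_iso (with_proj G \<restriction> W) (with_proj H)"
  obtains f where "bij_betw f W (pverts H)"
    "\<And>s t. s \<in> W \<Longrightarrow> t \<in> W \<Longrightarrow> (s, t) \<in> parcs G \<longleftrightarrow> (f s, f t) \<in> parcs H"
proof -
  obtain h where h: "pre_digraph.digraph_isomorphism (with_proj G \<restriction> W) h"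
    and H: "with_proj H = app_iso h (with_proj G \<restriction> W)"
    using iso by (auto simp: digraph_iso_def)
  have inj: "inj_on (iso_verts h) W"
    and ends: "\<And>a. a \<in> parcs G \<Longrightarrow> fst a \<in> W \<Longrightarrow> snd a \<in> W \<Longrightarrow>
      iso_verts h (fst a) = iso_tail h (iso_arcs h a) \<and> iso_verts h (snd a) = iso_head h (iso_arcs h a)"
    using h by (auto simp: pre_digraph.digraph_isomorphism_def)
  have tl: "iso_tail h = fst" "iso_head h = snd"
    using arg_cong[OF H, of tail] arg_cong[OF H, of head] by simp_all
  have V: "pverts H = iso_verts h ` W" using arg_cong[OF H, of verts] by simp
  have A: "parcs H = iso_arcs h ` {e \<in> parcs G. fst e \<in> W \<and> snd e \<in> W}"
    using arg_cong[OF H, of arcs] by simp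
  have iff: "(s, t) \<in> parcs G \<longleftrightarrow> (iso_verts h s, iso_verts h t) \<in> parcs H"
    if st: "s \<in> W" "t \<in> W" for s t
  proof
    assume e: "(s, t) \<in> parcs G"
    then have "iso_arcs h (s, t) \<in> parcs H" unfolding A using st by auto
    moreover have "iso_arcs h (s, t) = (iso_verts h s, iso_verts h t)"
      using ends[OF e] st tl by (simp add: prod_eq_iff)
    ultimately show "(iso_verts h s, iso_verts h t) \<in> parcs H" by simp
  next
    assume "(iso_verts h s, iso_verts h t) \<in> parcs H"
    then obtain e where e: "e \<in> parcs G" "fst e \<in> W" "snd e \<in> W"
      "iso_arcs h e = (iso_verts h s, iso_verts h t)" unfolding A by auto
    then have "iso_verts h (fst e) = iso_verts h s" "iso_verts h (snd e) = iso_verts h t"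
      using ends[OF e(1-3)] tl by auto
    then have "fst e = s" "snd e = t" using inj e st by (auto dest: inj_onD)
    then show "(s, t) \<in> parcs G" using e(1) by auto
  qed
  show thesis
    by (rule that[of "iso_verts h"]) (use inj V iff in \<open>auto simp: bij_betw_def\<close>)
qed

text \<open>One isomorphism onto the grid is chosen for each vertex; its two components serve as row
  and column.\<close>

lemma connected_locally_grid_local_grid:
  assumes n: "2 \<le> n" and G: "connected_locally_grid n G"
  obtains rw cl where "local_grid (pverts G) (\<lambda>x y. (x, y) \<in> parcs G) n (graph_dist G) rw cl"
proof -
  interpret pair_graph G using G by (simp add: connected_locally_grid_def)
  interpret connected_pair_graph G
    by unfold_locales (use G in \<open>simp add: connected_locally_grid_def\<close>)
  have "\<exists>f. bij_betw f (neighbourhood G x) (pverts (grid n)) \<and>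
      (\<forall>s\<in>neighbourhood G x. \<forall>t\<in>neighbourhood G x. (s, t) \<in> parcs G \<longleftrightarrow> (f s, f t) \<in> parcs (grid n))"
    if "x \<in> pverts G" for x
  proof -
    have "digraph_iso (with_proj G \<restriction> neighbourhood G x) (with_proj (grid n))"
      using G that by (simp add: connected_locally_grid_def locally_grid_def)
    then show ?thesis by (rule digraph_iso_pairD) blast
  qed
  then obtain f where bij: "\<And>x. x \<in> pverts G \<Longrightarrow> bij_betw (f x) (neighbourhood G x) (pverts (grid n))"
    and adj: "\<And>x s t. x \<in> pverts G \<Longrightarrow> s \<in> neighbourhood G x \<Longrightarrow> t \<in> neighbourhood G x \<Longrightarrow>
      (s, t) \<in> parcs G \<longleftrightarrow> (f x s, f x t) \<in> parcs (grid n)"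
    by metis
  have "local_grid (pverts G) (\<lambda>x y. (x, y) \<in> parcs G) n (graph_dist G)
      (\<lambda>x s. fst (f x s)) (\<lambda>x s. snd (f x s))"
  proof
    fix x s t
    show "x \<in> pverts G \<Longrightarrow> bij_betw (\<lambda>s. (fst (f x s), snd (f x s))) {s. (x, s) \<in> parcs G} ({1..n} \<times> {1..n})"
      using bij by (simp add: neighbourhood_def pverts_grid)
    assume st: "(x, s) \<in> parcs G" "(x, t) \<in> parcs G"
    then have x: "x \<in> pverts G" by (auto dest: in_arcsD1)
    have st': "s \<in> neighbourhood G x" "t \<in> neighbourhood G x" using st by (auto simp: neighbourhood_def)
    have "f x s \<in> {1..n} \<times> {1..n}" "f x t \<in> {1..n} \<times> {1..n}"
      using bij_betwE[OF bij[OF x]] st' by (auto simp: pverts_grid)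
    then have "(f x s, f x t) \<in> parcs (grid n) \<longleftrightarrow>
        (fst (f x s) = fst (f x t)) \<noteq> (snd (f x s) = snd (f x t))"
      by (cases "f x s"; cases "f x t") (auto simp: parcs_grid_iff)
    then show "(s, t) \<in> parcs G \<longleftrightarrow> (fst (f x s) = fst (f x t)) \<noteq> (snd (f x s) = snd (f x t))"
      using adj[OF x st'] by blast
  next
    show "\<And>x y. (x, y) \<in> parcs G \<Longrightarrow> x \<in> pverts G" by (rule in_arcsD1)
    show "\<And>x y. (x, y) \<in> parcs G \<Longrightarrow> (y, x) \<in> parcs G" by (rule sym_parcs)
    show "\<And>x. (x, x) \<notin> parcs G" using no_loops' by blast
  qed (fact pair_finite_verts pverts_nonempty n graph_dist_eq_0 graph_dist_sym graph_dist_triangle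
      graph_dist_pred graph_dist_adj)+
  then show thesis by (rule that)
qed

section \<open>Finitely many graphs of bounded order up to isomorphism\<close>

lemma finite_pair_digraphs_lessThan:
  "finite {H :: nat pair_pre_digraph. pverts H \<subseteq> {..<K} \<and> parcs H \<subseteq> {..<K} \<times> {..<K}}"
proof -
  have "{H :: nat pair_pre_digraph. pverts H \<subseteq> {..<K} \<and> parcs H \<subseteq> {..<K} \<times> {..<K}} \<subseteq>
      (\<lambda>(A, B). \<lparr>pverts = A, parcs = B\<rparr>) ` (Pow {..<K} \<times> Pow ({..<K} \<times> {..<K}))"
  proof
    fix H :: "nat pair_pre_digraph"
    assume "H \<in> {H. pverts H \<subseteq> {..<K} \<and> parcs H \<subseteq> {..<K} \<times> {..<K}}"
    then show "H \<in> (\<lambda>(A, B). \<lparr>pverts = A, parcs = B\<rparr>) ` (Pow {..<K} \<times> Pow ({..<K} \<times> {..<K}))"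
      by (intro image_eqI[of _ _ "(pverts H, parcs H)"]) auto
  qed
  then show ?thesis by (rule finite_subset) simp
qed

lemma pair_graph_iso_lessThan:
  assumes "pair_graph G" and K: "card (pverts G) \<le> K"
  obtains H :: "nat pair_pre_digraph" where "pverts H \<subseteq> {..<K}" "parcs H \<subseteq> {..<K} \<times> {..<K}"
    "digraph_iso (with_proj G) (with_proj H)"
proof -
  interpret pair_graph G by fact
  obtain h where h: "bij_betw h (pverts G) {0..<card (pverts G)}"
    using ex_bij_betw_finite_nat[OF pair_finite_verts] by blast
  define H where "H = \<lparr>pverts = h ` pverts G, parcs = map_prod h h ` parcs G\<rparr>"
  define F where "F = \<lparr>iso_verts = h, iso_arcs = map_prod h h, iso_head = snd, iso_tail = fst\<rparr>"
  have sub: "parcs G \<subseteq> pverts G \<times> pverts G" by (auto dest: in_arcsD1 in_arcsD2)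
  have hV: "h ` pverts G \<subseteq> {..<K}" using bij_betw_imp_surj_on[OF h] K by auto
  have inj: "inj_on h (pverts G)" using h by (rule bij_betw_imp_inj_on)
  have "inj_on (map_prod h h) (parcs G)"
    using inj_on_subset[OF map_prod_inj_on[OF inj inj] sub] .
  then have "digraph_isomorphism F"
    using inj wf_digraph_axioms by (simp add: digraph_isomorphism_def F_def)
  moreover have "with_proj H = app_iso F (with_proj G)"
    by (simp add: with_proj_def app_iso_def H_def F_def)
  ultimately have "digraph_iso (with_proj G) (with_proj H)" unfolding digraph_iso_def by blast
  moreover have "pverts H \<subseteq> {..<K}" using hV by (simp add: H_def)
  moreover have "parcs H \<subseteq> {..<K} \<times> {..<K}" using hV sub by (fastforce simp: H_def)
  ultimately show thesis using that by blast
qed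

section \<open>Locally grid pair graphs\<close>

locale locally_grid_graph = connected_pair_graph G +
    local_grid "pverts G" "\<lambda>x y. (x, y) \<in> parcs G" n "graph_dist G" rw cl
  for G :: "'a pair_pre_digraph" and n :: nat and rw cl :: "'a \<Rightarrow> 'a \<Rightarrow> nat"
begin

lemma nb_eq_neighbourhood: "nb = neighbourhood G"
  by (simp add: fun_eq_iff nb_def neighbourhood_def)

lemma mu_orders_eq:
  "mu_orders G = {card (cn x y) | x y. x \<in> pverts G \<and> y \<in> pverts G \<and> graph_dist G x y = 2}"
  by (simp add: mu_orders_def mu_graph_def cn_def nb_eq_neighbourhood)

lemma ball_mu_orders:
  "(\<forall>k\<in>mu_orders G. P k) \<longleftrightarrow>
    (\<forall>x\<in>pverts G. \<forall>y\<in>pverts G. graph_dist G x y = 2 \<longrightarrow> P (card (cn x y)))"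
  by (auto simp: mu_orders_eq)

lemma mu_orders_bounds: "k \<in> mu_orders G \<Longrightarrow> even k \<and> 4 \<le> k \<and> k \<le> 2 * n"
  using mu_bounds by (auto simp: mu_orders_eq)

lemma diameter_le: "(\<And>x y. x \<in> pverts G \<Longrightarrow> y \<in> pverts G \<Longrightarrow> graph_dist G x y \<le> m) \<Longrightarrow> diameter G \<le> m"
  using diameter_attained by metis

lemma mu_big_iff: "mu_big \<longleftrightarrow> (\<forall>k\<in>mu_orders G. 2 * (n - 1) \<le> k)"
  by (simp add: mu_big_def ball_mu_orders)

end

lemma locally_grid_graph_obtain:
  assumes n: "2 \<le> n" and G: "connected_locally_grid n G"
  obtains rw cl where "locally_grid_graph G n rw cl"
proof -
  obtain rw cl where "local_grid (pverts G) (\<lambda>x y. (x, y) \<in> parcs G) n (graph_dist G) rw cl"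
    using connected_locally_grid_local_grid[OF n G] .
  moreover have "connected_pair_graph G"
    using G by (simp add: connected_locally_grid_def connected_pair_graph_def connected_pair_graph_axioms_def)
  ultimately show thesis using that by (simp add: locally_grid_graph_def)
qed

locale tight_locally_grid_graph = locally_grid_graph +
  assumes mu_orders_tight: "k \<in> mu_orders G \<Longrightarrow> k = 2 * (n - 1)"
begin

sublocale tight_local_grid "pverts G" "\<lambda>x y. (x, y) \<in> parcs G" n "graph_dist G" rw cl
  by unfold_locales (use mu_orders_tight in \<open>auto simp: mu_orders_eq\<close>)

lemma diameter_eq: "diameter G = 3"
proof (rule antisym)
  show "diameter G \<le> 3" by (rule diameter_le) (rule d3)
  show "3 \<le> diameter G" using antipode_ex graph_dist_le_diameter by metis
qed

lemma distance_regular: "distance_regular G [n ^ 2, (n - 1) ^ 2, 1] [1, 2 * (n - 1), n ^ 2]"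
  unfolding distance_regular_def diameter_eq
proof (intro conjI ballI allI impI)
  fix x y i assume x: "x \<in> pverts G" and y: "y \<in> pverts G" and d: "graph_dist G x y = i"
  have nxt: "{z \<in> neighbourhood G y. graph_dist G x z = i + 1} = nxt x y"
    using d by (simp add: nxt_def nb_eq_neighbourhood)
  have nb1: "(x, y) \<in> parcs G" if "i = 1" using d_1_adj[OF x y] d that by simp
  show "card {z \<in> neighbourhood G y. graph_dist G x z = i + 1} = [n ^ 2, (n - 1) ^ 2, 1] ! i" if i: "i < 3"
  proof -
    consider "i = 0" | "i = 1" | "i = 2" using i by linarith
    then show ?thesis
    proof cases
      case 1
      then have "nxt x y = nb y" using d d_eq_0[OF x y] d_adj by (auto simp: nxt_def nb_def)
      then show ?thesis unfolding nxt using card_nb[OF y] 1 by simp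
    next
      case 2
      have "nxt x y = {t \<in> nb y. t \<noteq> x \<and> (x, t) \<notin> parcs G}"
        unfolding nxt_def
      proof (rule Collect_cong)
        fix t
        show "t \<in> nb y \<and> graph_dist G x t = Suc (graph_dist G x y) \<longleftrightarrow>
            t \<in> nb y \<and> t \<noteq> x \<and> (x, t) \<notin> parcs G"
        proof (cases "t \<in> nb y")
          case True
          then have yt: "(y, t) \<in> parcs G" and tV: "t \<in> pverts G"
            by (auto simp: nb_def dest: in_arcsD2)
          show ?thesis
            using True d_step[OF yt x] d 2 d_eq_0[OF x tV] d_1_adj[OF x tV] by auto
        qed simp
      qed
      then show ?thesis unfolding nxt using card_nonadj[OF nb1[OF 2]] 2 by simp
    next
      case 3
      then show ?thesis unfolding nxt using card_nxt_eq[OF x y] d by simp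
    qed
  qed
  show "card {z \<in> neighbourhood G y. graph_dist G x z = i - 1} = [1, 2 * (n - 1), n ^ 2] ! (i - 1)" if i: "1 \<le> i"
  proof -
    have prv: "{z \<in> neighbourhood G y. graph_dist G x z = i - 1} = prv x y"
      using d i by (auto simp: prv_def nb_eq_neighbourhood)
    have "i \<le> 3" using d3[OF x y] d by simp
    then consider "i = 1" | "i = 2" | "i = 3" using i by linarith
    then show ?thesis
    proof cases
      case 1
      have "prv x y = {x}"
      proof (intro equalityI subsetI)
        fix z assume "z \<in> prv x y"
        then have "(y, z) \<in> parcs G" "graph_dist G x z = 0" using d 1 by (auto simp: prv_def nb_def)
        then show "z \<in> {x}" using d_eq_0[OF x, of z] by (auto dest: in_arcsD2)
      next
        fix z assume "z \<in> {x}"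
        then show "z \<in> prv x y"
          using sym_parcs[OF nb1[OF 1]] d 1 d_eq_0[OF x x] by (simp add: prv_def nb_def)
      qed
      then show ?thesis unfolding prv using 1 by simp
    next
      case 2
      then show ?thesis unfolding prv using prv_2[OF x] mu_eq[OF x y] d by simp
    next
      case 3
      have "prv x y = nb y" using nb_antipode[OF big x y] d 3 by (auto simp: prv_def nb_def)
      then show ?thesis unfolding prv using card_nb[OF y] 3 by simp
    qed
  qed
qed (use conn pair_graph_axioms in simp_all)

lemma antipodal_rel_eq: "antipodal_rel G = {(x, y). same x y}"
  by (simp add: antipodal_rel_def same_def)

lemma quotient_eq: "pverts G // antipodal_rel G = blocks"
  by (auto simp: quotient_def antipodal_rel_eq blocks_def block_def)

lemma antipodal_cover: "antipodal_cover ((n + 1) div 2) (n ^ 2 + 1) G"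
  unfolding antipodal_cover_def
proof (intro conjI ballI)
  show "\<exists>bs cs. distance_regular G bs cs" using distance_regular by blast
  show "diameter G = 3" by (rule diameter_eq)
  show "equiv (pverts G) (antipodal_rel G)"
    unfolding antipodal_rel_eq
  proof (rule equivI)
    show "{(x, y). same x y} \<subseteq> pverts G \<times> pverts G" by (auto simp: same_def)
    show "refl_on (pverts G) {(x, y). same x y}" by (auto simp: refl_on_def same_def)
    show "sym {(x, y). same x y}" using same_sym by (auto simp: sym_def)
    show "trans {(x, y). same x y}" using same_trans by (auto simp: trans_def)
  qed
  show "card B = (n + 1) div 2" if "B \<in> pverts G // antipodal_rel G" for B
    using that card_block r_eq unfolding quotient_eq by (auto simp: blocks_def)
  have "pverts (quotient_graph G (antipodal_rel G)) = blocks"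
    by (simp add: quotient_graph_def quotient_eq)
  moreover have "parcs (quotient_graph G (antipodal_rel G)) = {(A, B). (A, B) \<in> blocks \<times> blocks \<and> A \<noteq> B}"
    using qadj_all by (auto simp: quotient_graph_def quotient_eq qadj_def)
  ultimately show "complete_digraph (n ^ 2 + 1) (with_proj (quotient_graph G (antipodal_rel G)))"
    unfolding complete_digraph_pair_def using quotient.finite_X card_blocks_eq by simp
qed

end

theorem theorem1p1:
  fixes n :: nat
  assumes "n \<ge> 2"
  shows
    "(\<forall>\<Gamma> :: 'a pair_pre_digraph. connected_locally_grid n \<Gamma> \<longrightarrow>
        (\<forall>k \<in> mu_orders \<Gamma>. even k \<and> 4 \<le> k \<and> k \<le> 2 * n))
     \<and>
     (\<exists>F :: nat pair_pre_digraph set. finite F \<and>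
        (\<forall>\<Gamma> :: 'a pair_pre_digraph.
           connected_locally_grid n \<Gamma> \<and> (\<forall>k \<in> mu_orders \<Gamma>. k \<ge> n - 1) \<longrightarrow>
           (\<exists>H \<in> F. digraph_iso (with_proj \<Gamma>) (with_proj H))))
     \<and>
     (\<forall>\<Gamma> :: 'a pair_pre_digraph.
        connected_locally_grid n \<Gamma> \<and> (\<forall>k \<in> mu_orders \<Gamma>. k \<ge> n - 1) \<longrightarrow>
        real (card (pverts \<Gamma>)) \<le> real n ^ 3 * (real n + 5) / 4 \<and>
        int (diameter \<Gamma>) \<le>
          2 + \<lceil>ln (real n ^ 2 * (real n - 1)) / (2 * ln ((real n + 1) / (real n - 1)))\<rceil>)
     \<and>
     (\<forall>\<Gamma> :: 'a pair_pre_digraph.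
        connected_locally_grid n \<Gamma> \<and> (\<forall>k \<in> mu_orders \<Gamma>. k \<ge> 2 * (n - 1)) \<longrightarrow>
        int (card (pverts \<Gamma>)) \<le> \<lfloor>(real n ^ 2 + 1) * (real n + 1) / 2\<rfloor> \<and>
        diameter \<Gamma> \<le> 3)
     \<and>
     (\<forall>\<Gamma> :: 'a pair_pre_digraph.
        connected_locally_grid n \<Gamma> \<and> (\<forall>k \<in> mu_orders \<Gamma>. k \<ge> 2 * (n - 1)) \<longrightarrow>
        (int (card (pverts \<Gamma>)) = \<lfloor>(real n ^ 2 + 1) * (real n + 1) / 2\<rfloor> \<longleftrightarrow>
          (\<forall>k \<in> mu_orders \<Gamma>. k = 2 * (n - 1))) \<and>
        ((\<forall>k \<in> mu_orders \<Gamma>. k = 2 * (n - 1)) \<longrightarrow>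
          odd n \<and> diameter \<Gamma> = 3 \<and>
          distance_regular \<Gamma> [n ^ 2, (n - 1) ^ 2, 1] [1, 2 * (n - 1), n ^ 2] \<and>
          antipodal_cover ((n + 1) div 2) (n ^ 2 + 1) \<Gamma>))"
proof (intro conjI allI impI; (elim conjE)?)
  fix \<Gamma> :: "'a pair_pre_digraph"
  assume G: "connected_locally_grid n \<Gamma>"
  obtain rw cl where "locally_grid_graph \<Gamma> n rw cl" using locally_grid_graph_obtain[OF assms G] .
  then show "\<forall>k \<in> mu_orders \<Gamma>. even k \<and> 4 \<le> k \<and> k \<le> 2 * n"
    using locally_grid_graph.mu_orders_bounds by blast
next
  have bounds: "real (card (pverts \<Gamma>)) \<le> real n ^ 3 * (real n + 5) / 4 \<and>
      int (diameter \<Gamma>) \<le>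
        2 + \<lceil>ln (real n ^ 2 * (real n - 1)) / (2 * ln ((real n + 1) / (real n - 1)))\<rceil>"
    if G: "connected_locally_grid n \<Gamma>" and k: "\<forall>k \<in> mu_orders \<Gamma>. k \<ge> n - 1"
    for \<Gamma> :: "'a pair_pre_digraph"
  proof -
    obtain rw cl where "locally_grid_graph \<Gamma> n rw cl" using locally_grid_graph_obtain[OF assms G] .
    then interpret locally_grid_graph \<Gamma> n rw cl .
    have mu: "\<And>x y. x \<in> pverts \<Gamma> \<Longrightarrow> y \<in> pverts \<Gamma> \<Longrightarrow> graph_dist \<Gamma> x y = 2 \<Longrightarrow> n - 1 \<le> card (cn x y)"
      using k by (simp add: ball_mu_orders)
    obtain x y where xy: "x \<in> pverts \<Gamma>" "y \<in> pverts \<Gamma>" and diam: "diameter \<Gamma> = graph_dist \<Gamma> x y"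
      using diameter_attained .
    show ?thesis unfolding diam by (rule conjI[OF order_bound[OF mu] distance_bound[OF mu xy]])
  qed
  then show
    "\<And>\<Gamma> :: 'a pair_pre_digraph. connected_locally_grid n \<Gamma> \<Longrightarrow> \<forall>k \<in> mu_orders \<Gamma>. k \<ge> n - 1 \<Longrightarrow>
      real (card (pverts \<Gamma>)) \<le> real n ^ 3 * (real n + 5) / 4"
    "\<And>\<Gamma> :: 'a pair_pre_digraph. connected_locally_grid n \<Gamma> \<Longrightarrow> \<forall>k \<in> mu_orders \<Gamma>. k \<ge> n - 1 \<Longrightarrow>
      int (diameter \<Gamma>) \<le>
        2 + \<lceil>ln (real n ^ 2 * (real n - 1)) / (2 * ln ((real n + 1) / (real n - 1)))\<rceil>"
    by blast+
  \<comment> \<open>Any natural bound on the order will do here; omitting the division by 4 avoids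
    rounding.\<close>
  define K where "K = n ^ 3 * (n + 5)"
  define F where "F = {H :: nat pair_pre_digraph. pverts H \<subseteq> {..<K} \<and> parcs H \<subseteq> {..<K} \<times> {..<K}}"
  have "\<exists>H\<in>F. digraph_iso (with_proj \<Gamma>) (with_proj H)"
    if G: "connected_locally_grid n \<Gamma>" and k: "\<forall>k \<in> mu_orders \<Gamma>. k \<ge> n - 1"
    for \<Gamma> :: "'a pair_pre_digraph"
  proof -
    have "real (card (pverts \<Gamma>)) \<le> real n ^ 3 * (real n + 5) / 4" using bounds[OF G k] by blast
    also have "\<dots> \<le> real n ^ 3 * (real n + 5)" by simp
    also have "\<dots> = real K" by (simp add: K_def)
    finally have le: "card (pverts \<Gamma>) \<le> K" by simp
    have pg: "pair_graph \<Gamma>" using G by (simp add: connected_locally_grid_def)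
    obtain H :: "nat pair_pre_digraph" where "pverts H \<subseteq> {..<K}" "parcs H \<subseteq> {..<K} \<times> {..<K}"
      "digraph_iso (with_proj \<Gamma>) (with_proj H)" using pair_graph_iso_lessThan[OF pg le] .
    then show ?thesis by (auto simp: F_def)
  qed
  moreover have "finite F" unfolding F_def by (rule finite_pair_digraphs_lessThan)
  ultimately show "\<exists>F :: nat pair_pre_digraph set. finite F \<and>
      (\<forall>\<Gamma> :: 'a pair_pre_digraph.
        connected_locally_grid n \<Gamma> \<and> (\<forall>k \<in> mu_orders \<Gamma>. k \<ge> n - 1) \<longrightarrow>
        (\<exists>H \<in> F. digraph_iso (with_proj \<Gamma>) (with_proj H)))"
    by blast
next
  fix \<Gamma> :: "'a pair_pre_digraph"
  assume G: "connected_locally_grid n \<Gamma>" and k: "\<forall>k \<in> mu_orders \<Gamma>. k \<ge> 2 * (n - 1)"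
  obtain rw cl where "locally_grid_graph \<Gamma> n rw cl" using locally_grid_graph_obtain[OF assms G] .
  then interpret locally_grid_graph \<Gamma> n rw cl .
  have b: mu_big using k by (simp add: mu_big_iff)
  have "(real n ^ 2 + 1) * (real n + 1) / 2 = real_of_int (int ((n ^ 2 + 1) * (n + 1))) / real_of_int 2"
    by (simp add: algebra_simps)
  then have fl: "\<lfloor>(real n ^ 2 + 1) * (real n + 1) / 2\<rfloor> = int ((n ^ 2 + 1) * (n + 1)) div 2"
    by (simp only: floor_divide_of_int_eq)
  have le: "2 * card (pverts \<Gamma>) \<le> (n ^ 2 + 1) * (n + 1)" using order_bound_mu_big[OF b] .
  show "int (card (pverts \<Gamma>)) \<le> \<lfloor>(real n ^ 2 + 1) * (real n + 1) / 2\<rfloor>"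
    unfolding fl using le by linarith
  show "diameter \<Gamma> \<le> 3" by (rule diameter_le) (rule d_le_3[OF b])
  have tight: "tight_locally_grid_graph \<Gamma> n rw cl" if "\<forall>k \<in> mu_orders \<Gamma>. k = 2 * (n - 1)"
    by unfold_locales (use that in blast)
  show "int (card (pverts \<Gamma>)) = \<lfloor>(real n ^ 2 + 1) * (real n + 1) / 2\<rfloor> \<longleftrightarrow>
      (\<forall>k \<in> mu_orders \<Gamma>. k = 2 * (n - 1))"
  proof
    assume eq: "int (card (pverts \<Gamma>)) = \<lfloor>(real n ^ 2 + 1) * (real n + 1) / 2\<rfloor>"
    \<comment> \<open>A mu-graph of another order would put the number of vertices strictly below
      the floor, by \<open>order_bound_strict\<close>.\<close>
    have "\<not> 2 * card (pverts \<Gamma>) + 2 \<le> (n ^ 2 + 1) * (n + 1)" using eq unfolding fl by linarith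
    then show "\<forall>k \<in> mu_orders \<Gamma>. k = 2 * (n - 1)"
      unfolding ball_mu_orders using order_bound_strict[OF b] by blast
  next
    assume "\<forall>k \<in> mu_orders \<Gamma>. k = 2 * (n - 1)"
    then interpret tight_locally_grid_graph \<Gamma> n rw cl by (rule tight)
    show "int (card (pverts \<Gamma>)) = \<lfloor>(real n ^ 2 + 1) * (real n + 1) / 2\<rfloor>"
      unfolding fl using card_V_eq by linarith
  qed
  assume "\<forall>k \<in> mu_orders \<Gamma>. k = 2 * (n - 1)"
  then interpret tight_locally_grid_graph \<Gamma> n rw cl by (rule tight)
  show "odd n" "diameter \<Gamma> = 3"
    "distance_regular \<Gamma> [n ^ 2, (n - 1) ^ 2, 1] [1, 2 * (n - 1), n ^ 2]"
    "antipodal_cover ((n + 1) div 2) (n ^ 2 + 1) \<Gamma>"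
    by (rule odd_n diameter_eq distance_regular antipodal_cover)+
qed

end
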